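(* Let $\rho$ be an admissible weight on $[0,+\infty[$ and let $(T_t)_{t\ge0}$ be the translation semigroup on $C_0^\rho([0,+\infty[)$. If $\int_0^{+\infty}\rho(s)\,ds<+\infty$, then $(T_t)_{t\ge0}$ satisfies the Frequent Hypercyclicity Criterion for semigroups.
   Context: An admissible weight on $[0,+\infty[$ is a measurable function $\rho:[0,+\infty[\to\mathbb{R}$ such that $\rho(t)>0$ for all $t\ge0$ and there exist constants $M\ge1$, $\omega\in\mathbb{R}$ with $\rho(\tau)\le Me^{\omega t}\rho(\tau+t)$ for all $\tau\in[0,+\infty[$ and all $t>0$. $C_0^\rho([0,+\infty[)$ is the Banach space of continuous functions $u:[0,+\infty[\to\mathbb{R}$ with $\lim_{x\to\infty}u(x)\rho(x)=0$, with norm $\|u\|_\infty=\sup_{t\in[0,+\infty[}|u(t)|\rho(t)$. The translation semigroup is $T_tf(x)=f(x+t)$, $t\ge0$, $x\ge0$; it is a $C_0$-semigroup on this space. A $C_0$-semigroup $(T_t)_{t\ge0}$ on a separable Banach space $X$ satisfies the Frequent Hypercyclicity Criterion for semigroups if there exist a dense subset $X_0\subseteq X$ and maps $S_t:X_0\to X$, $t>0$ (not assumed linear or continuous), such that: (i) $T_tS_tx=x$ and $T_tS_rx=S_{r-t}x$ for all $x\in X_0$, $t>0$, $r>t>0$; (ii) $t\mapsto T_tx$ is Pettis integrable on $[0,+\infty[$ for all $x\in X_0$; (iii) $t\mapsto S_tx$ is Pettis integrable on $[0,+\infty[$ for all $x\in X_0$. Here $f:[0,+\infty[\to X$ (possibly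 undefined at $0$) is Pettis integrable (with respect to Lebesgue measure $\mu$) if for every $\varphi\in X'$ (the topological dual) the function $\varphi\circ f$ is measurable and in $L^1([0,+\infty[)$, and for every measurable $E\subseteq[0,+\infty[$ there is $x_E\in X$ with $\varphi(x_E)=\int_E\varphi\circ f\,d\mu$ for all $\varphi\in X'$. *)

theory Defs
  imports "HOL-Analysis.Analysis" "HOL-Library.Function_Algebras"
begin

instantiation "fun" :: (type, real_vector) real_vector
begin

definition scaleR_fun :: "real \<Rightarrow> ('a \<Rightarrow> 'b) \<Rightarrow> 'a \<Rightarrow> 'b"
  where "scaleR_fun c f = (\<lambda>x. c *\<^sub>R f x)"

instance
  by standard (auto simp: scaleR_fun_def plus_fun_def scaleR_add_right scaleR_add_left)

end


section \<open>Normed spaces with an explicit carrier\<close>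

text \<open>
  The norm of the weighted space below depends on the weight, a term variable, so the type class
  of real normed vector spaces does not apply. A normed space is given by a linear subspace V of
  a real vector space together with a norm that only has to behave well on V.
\<close>

definition norm_dist :: "'a::real_vector set \<Rightarrow> ('a \<Rightarrow> real) \<Rightarrow> 'a \<Rightarrow> 'a \<Rightarrow> real"
  where "norm_dist V N u v = (if u \<in> V \<and> v \<in> V then N (u - v) else 0)"
  \<comment> \<open>The value off V is irrelevant, but the locale Metric_space asks for
      nonnegativity and symmetry on the whole type.\<close>

locale normed_space_on =
  fixes V :: "'a::real_vector set" and N :: "'a \<Rightarrow> real"
  assumes subspace_carrier: "subspace V"
    and norm_eq_0: "u \<in> V \<Longrightarrow> N u = 0 \<longleftrightarrow> u = 0"
    and norm_scale: "u \<in> V \<Longrightarrow> N (c *\<^sub>R u) = \<bar>c\<bar> * N u"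
    and norm_triangle: "u \<in> V \<Longrightarrow> v \<in> V \<Longrightarrow> N (u + v) \<le> N u + N v"
begin

lemma norm_minus_swap:
  assumes "u \<in> V" "v \<in> V"
  shows "N (u - v) = N (v - u)"
  using norm_scale[of "v - u" "-1"] assms subspace_diff[OF subspace_carrier] by simp

lemma norm_nonneg:
  assumes "u \<in> V"
  shows "0 \<le> N u"
proof -
  have m: "-u \<in> V" using assms subspace_carrier subspace_neg by blast
  have "N (u + -u) \<le> N u + N (-u)" using norm_triangle[OF assms m] .
  moreover have "N (-u) = N u" using norm_scale[OF assms, of "-1"] by simp
  moreover have "N 0 = 0" using norm_eq_0 subspace_0[OF subspace_carrier] by blast
  ultimately show ?thesis by simp
qed

sublocale Metric_space V "norm_dist V N"
proof
  fix x y z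
  show "0 \<le> norm_dist V N x y"
    using subspace_diff[OF subspace_carrier] by (auto simp: norm_dist_def intro: norm_nonneg)
  show "norm_dist V N x y = norm_dist V N y x"
    by (auto simp: norm_dist_def norm_minus_swap)
  show "norm_dist V N x y = 0 \<longleftrightarrow> x = y" if "x \<in> V" "y \<in> V"
    using that norm_eq_0[of "x - y"] subspace_diff[OF subspace_carrier]
    by (auto simp: norm_dist_def)
  show "norm_dist V N x z \<le> norm_dist V N x y + norm_dist V N y z"
    if "x \<in> V" "y \<in> V" "z \<in> V"
    using that norm_triangle[of "x - y" "y - z"] subspace_diff[OF subspace_carrier]
    by (auto simp: norm_dist_def)
qed

end

locale separable_banach_space_on = normed_space_on V N
  for V :: "'a::real_vector set" and N +
  assumes complete: mcomplete
    and separable: "separable_space mtopology"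

definition bounded_linear_on ::
  "'a::real_vector set \<Rightarrow> ('a \<Rightarrow> real) \<Rightarrow> ('b::real_vector \<Rightarrow> real) \<Rightarrow> ('a \<Rightarrow> 'b) \<Rightarrow> bool"
  where "bounded_linear_on V N N' f \<longleftrightarrow>
    (\<forall>u\<in>V. \<forall>v\<in>V. f (u + v) = f u + f v) \<and>
    (\<forall>c. \<forall>u\<in>V. f (c *\<^sub>R u) = c *\<^sub>R f u) \<and>
    (\<exists>K. \<forall>u\<in>V. N' (f u) \<le> K * N u)"

text \<open>
  Functionals are total functions on the ambient type of which only the restriction to V
  matters, so each element of the dual space is represented by many members of this set.
\<close>
definition topological_dual :: "'a::real_vector set \<Rightarrow> ('a \<Rightarrow> real) \<Rightarrow> ('a \<Rightarrow> real) set"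
  where "topological_dual V N = {\<phi>. bounded_linear_on V N abs \<phi>}"

locale C0_semigroup_on = separable_banach_space_on V N
  for V :: "'a::real_vector set" and N +
  fixes T :: "real \<Rightarrow> 'a \<Rightarrow> 'a"
  assumes maps_to: "0 \<le> t \<Longrightarrow> u \<in> V \<Longrightarrow> T t u \<in> V"
    and bounded_linear: "0 \<le> t \<Longrightarrow> bounded_linear_on V N N (T t)"
    and at_0: "u \<in> V \<Longrightarrow> T 0 u = u"
    and semigroup: "0 \<le> s \<Longrightarrow> 0 \<le> t \<Longrightarrow> u \<in> V \<Longrightarrow> T (s + t) u = T s (T t u)"
    and strongly_continuous: "u \<in> V \<Longrightarrow> limitin mtopology (\<lambda>t. T t u) u (at_right 0)"


section \<open>Pettis integrability and the Frequent Hypercyclicity Criterion\<close>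

text \<open>
  Pettis integrability on the half-line. The function may be undefined at 0: its value
  there need not lie in V, and it does not affect the integrals because Lebesgue measure is
  complete and the point 0 is a null set.
\<close>
definition pettis_integrable ::
  "'a::real_vector set \<Rightarrow> ('a \<Rightarrow> real) \<Rightarrow> (real \<Rightarrow> 'a) \<Rightarrow> bool"
  where "pettis_integrable V N f \<longleftrightarrow>
    (\<forall>t>0. f t \<in> V) \<and>
    (\<forall>\<phi>\<in>topological_dual V N. set_integrable lebesgue {0..} (\<lambda>t. \<phi> (f t))) \<and>
    (\<forall>E\<in>sets lebesgue. E \<subseteq> {0..} \<longrightarrow>
      (\<exists>x\<in>V. \<forall>\<phi>\<in>topological_dual V N. \<phi> x = (LINT t:E|lebesgue. \<phi> (f t))))"

definition frequent_hypercyclicity_criterion ::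
  "'a::real_vector set \<Rightarrow> ('a \<Rightarrow> real) \<Rightarrow> (real \<Rightarrow> 'a \<Rightarrow> 'a) \<Rightarrow> bool"
  where "frequent_hypercyclicity_criterion V N T \<longleftrightarrow>
    C0_semigroup_on V N T \<and>
    (\<exists>X\<^sub>0 S. X\<^sub>0 \<subseteq> V \<and>
      Metric_space.mtopology V (norm_dist V N) closure_of X\<^sub>0 = V \<and>
      (\<forall>t>0. \<forall>x\<in>X\<^sub>0. S t x \<in> V) \<and>
      (\<forall>x\<in>X\<^sub>0. \<forall>t>0. T t (S t x) = x \<and> (\<forall>r>t. T t (S r x) = S (r - t) x)) \<and>
      (\<forall>x\<in>X\<^sub>0. pettis_integrable V N (\<lambda>t. T t x)) \<and>
      (\<forall>x\<in>X\<^sub>0. pettis_integrable V N (\<lambda>t. S t x)))"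


section \<open>The weighted function space and the translation semigroup\<close>

definition admissible_weight :: "(real \<Rightarrow> real) \<Rightarrow> bool"
  where "admissible_weight \<rho> \<longleftrightarrow>
    \<rho> \<in> borel_measurable (lebesgue_on {0..}) \<and>
    (\<forall>t\<ge>0. \<rho> t > 0) \<and>
    (\<exists>M \<omega>. M \<ge> 1 \<and> (\<forall>\<tau>\<ge>0. \<forall>t>0. \<rho> \<tau> \<le> M * exp (\<omega> * t) * \<rho> (\<tau> + t)))"

text \<open>
  A function on the closed half-line is represented by its extension by 0 to the real line, so that
  equality of functions and the pointwise vector space operations are the intended ones.
\<close>
definition C0_weighted :: "(real \<Rightarrow> real) \<Rightarrow> (real \<Rightarrow> real) set"
  where "C0_weighted \<rho> =
    {u. continuous_on {0..} u \<and> (\<forall>x<0. u x = 0) \<and> ((\<lambda>x. u x * \<rho> x) \<longlongrightarrow> 0) at_top}"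

definition weighted_norm :: "(real \<Rightarrow> real) \<Rightarrow> (real \<Rightarrow> real) \<Rightarrow> real"
  where "weighted_norm \<rho> u = (SUP t\<in>{0..}. \<bar>u t\<bar> * \<rho> t)"

definition translation :: "real \<Rightarrow> (real \<Rightarrow> real) \<Rightarrow> real \<Rightarrow> real"
  where "translation t f = (\<lambda>x. if 0 \<le> x then f (x + t) else 0)"

end

theory Submission
  imports Defs
begin

text \<open>
  The dense set of the criterion consists of the functions with compact support in
  \<open>[0, \<infinity>)\<close>. The space controls the value at 0, so functions vanishing at 0 are not dense,
  and shifting a function to the right and filling up with zeros would produce a jump. Instead, a
  compactly supported \<open>u\<close> is extended once and for all to a continuous compactly supported function
  \<open>U\<close> on the whole line, by a linear ramp on \<open>[-1, 0]\<close>; then \<open>S\<^sub>t u\<close> is the restriction of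
  \<open>x \<mapsto> U (x - t)\<close> to the half-line. The identities \<open>T\<^sub>t S\<^sub>t u = u\<close> and
  \<open>T\<^sub>t S\<^sub>r u = S\<^sub>r\<^sub>-\<^sub>t u\<close> are then immediate, because all the \<open>S\<^sub>r u\<close> come from the same \<open>U\<close>.

  If \<open>U\<close> is supported in \<open>[-1, a]\<close>, then \<open>S\<^sub>t u\<close> is supported in \<open>[t - 1, t + a]\<close>.
  An admissible weight at a point is at most a constant times its value a bounded distance
  later, so the norm of \<open>S\<^sub>t u\<close> is at most a constant times \<open>\<rho> (t + a + 1)\<close>, which is integrable
  in \<open>t\<close>; the same bound times \<open>\<epsilon>\<close> holds for \<open>S\<^sub>s u - S\<^sub>t u\<close> when \<open>s\<close> and \<open>t\<close> are
  close, by uniform continuity of \<open>U\<close>. On the other side \<open>T\<^sub>t u = 0\<close> for all large \<open>t\<close>. So both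
  orbits are norm continuous and dominated by an integrable function, and in a complete space this
  gives Pettis integrability (\<open>pettis_integrableI\<close>): the integral over a set is a limit of Riemann
  sums, which form a Cauchy sequence as one sees by testing against point evaluations times
  the weight, a family of functionals that determines the norm.

  That the translations form a \<open>C\<^sub>0\<close>-semigroup on a separable Banach space is part of the criterion.
  The weight may be discontinuous, but admissibility bounds it from above and away from 0 on bounded
  intervals. This suffices to carry over the arguments for the unweighted supremum norm: uniform limits give completeness, and Bernstein polynomials with rational
  coefficients, cut off to compact support, give a countable dense set.
\<close>

section \<open>Pettis integrals as limits of Riemann sums\<close>

lemma integral_tail_tendsto_0:
  fixes G :: "real \<Rightarrow> real"
  assumes "set_integrable lebesgue {0..} G"
  shows "(\<lambda>n::nat. LINT t:{real n..}|lebesgue. G t) \<longlonglongrightarrow> 0"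
proof -
  let ?g = "\<lambda>t. indicator {0..} t * G t"
  have int: "integrable lebesgue ?g"
    using assms by (simp add: set_integrable_def)
  have "(\<lambda>n::nat. LINT t|lebesgue. indicator {real n..} t * ?g t) \<longlonglongrightarrow> (LINT t::real|lebesgue. 0)"
  proof (rule integral_dominated_convergence[where w = "\<lambda>t. \<bar>?g t\<bar>"])
    show "(\<lambda>t. indicator {real n..} t * ?g t) \<in> borel_measurable lebesgue" for n
      by (intro borel_measurable_times borel_measurable_indicator
          borel_measurable_integrable[OF int]) simp
    show "AE t in lebesgue. (\<lambda>n. indicator {real n..} t * ?g t) \<longlonglongrightarrow> 0"
    proof (rule AE_I2)
      fix t :: real
      obtain m :: nat where "t < real m" using reals_Archimedean2 by blast
      then have "eventually (\<lambda>n. indicator {real n..} t * ?g t = 0) sequentially"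
        by (intro eventually_sequentiallyI[of m]) (auto simp: indicator_def)
      then show "(\<lambda>n. indicator {real n..} t * ?g t) \<longlonglongrightarrow> 0"
        by (rule tendsto_eventually)
    qed
  qed (use int in \<open>auto simp: indicator_def\<close>)
  moreover have "(LINT t|lebesgue. indicator {real n..} t * ?g t) = (LINT t:{real n..}|lebesgue. G t)" for n
    unfolding set_lebesgue_integral_def
    by (rule Bochner_Integration.integral_cong) (auto simp: indicator_def)
  ultimately show ?thesis by simp
qed

text \<open>
  The \<open>n\<^sup>2\<close> cells of length \<open>1 / n\<close> cover exactly \<open>[0, n)\<close>, so mesh and truncation of the Riemann
  sums below are governed by the single parameter \<open>n\<close>.
\<close>

lemma sum_indicator_grid:
  fixes a :: "nat \<Rightarrow> real"
  assumes "0 < n" "0 \<le> t" "t < real n"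
  obtains k where "real k / real n \<le> t" "t < (real k + 1) / real n"
    "(\<Sum>j<n*n. indicator {real j / real n..<(real j + 1) / real n} t * a j) = a k"
proof
  define k where "k = nat \<lfloor>t * real n\<rfloor>"
  have iff: "t \<in> {real j / real n..<(real j + 1) / real n} \<longleftrightarrow> j = k" for j
  proof -
    have "t \<in> {real j / real n..<(real j + 1) / real n} \<longleftrightarrow> real j \<le> t * real n \<and> t * real n < real j + 1"
      using assms by (auto simp: field_simps)
    also have "\<dots> \<longleftrightarrow> \<lfloor>t * real n\<rfloor> = int j"
      by (auto simp: floor_eq_iff)
    also have "\<dots> \<longleftrightarrow> j = k"
      using assms by (auto simp: k_def)
    finally show ?thesis .
  qed
  then show "real k / real n \<le> t" "t < (real k + 1) / real n" by auto
  have "real k \<le> t * real n" using assms by (simp add: k_def)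
  also have "\<dots> < real (n * n)" using assms by simp
  finally have "k < n * n" by (rule of_nat_less_imp_less)
  have "indicator {real j / real n..<(real j + 1) / real n} t = (if j = k then 1 else 0 :: real)" for j
    unfolding indicator_def iff by simp
  then show "(\<Sum>j<n*n. indicator {real j / real n..<(real j + 1) / real n} t * a j) = a k"
    using \<open>k < n * n\<close> by (simp add: if_distrib[of "\<lambda>x. x * _"] cong: if_cong)
qed

text \<open>
  The Riemann sum is the integral of a step function. On \<open>[0, n)\<close> it differs from \<open>h\<close> by at most
  \<open>e * G\<close>, since the mesh is below \<open>\<delta>\<close>; beyond \<open>n\<close> the step function vanishes and the error is the
  tail of \<open>h\<close>. Measuring the modulus of continuity relative to \<open>G\<close> keeps the first error finite on
  the unbounded domain.
\<close>

lemma riemann_sum_error: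
  fixes h G :: "real \<Rightarrow> real"
  assumes h: "set_integrable lebesgue {0..} h" and G: "set_integrable lebesgue {0..} G"
    and bound: "\<And>t. 0 \<le> t \<Longrightarrow> \<bar>h t\<bar> \<le> G t"
    and modulus: "\<And>s t. 0 \<le> s \<Longrightarrow> 0 \<le> t \<Longrightarrow> \<bar>s - t\<bar> < \<delta> \<Longrightarrow> \<bar>h s - h t\<bar> \<le> e * G t"
    and "0 \<le> e" "0 < n" "1 / real n < \<delta>"
    and E: "E \<in> sets lebesgue" "E \<subseteq> {0..}"
  shows "\<bar>(\<Sum>k<n*n. measure lebesgue (E \<inter> {real k / real n..<(real k + 1) / real n}) * h (real k / real n))
      - (LINT t:E|lebesgue. h t)\<bar>
    \<le> e * (LINT t:{0..}|lebesgue. G t) + (LINT t:{real n..}|lebesgue. G t)"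
proof -
  define I where "I k = {real k / real n..<(real k + 1) / real n}" for k
  define s where "s t = (\<Sum>k<n*n. indicator (E \<inter> I k) t * h (real k / real n))" for t
  have lm: "E \<inter> I k \<in> lmeasurable" for k
  proof (rule bounded_set_imp_lmeasurable)
    show "bounded (E \<inter> I k)"
      by (rule bounded_subset[OF bounded_closed_interval[of "real k / real n" "(real k + 1) / real n"]])
        (auto simp: I_def)
    show "E \<inter> I k \<in> sets lebesgue" using E by (auto simp: I_def)
  qed
  have int_ind: "integrable lebesgue (\<lambda>t. indicator (E \<inter> I k) t * h (real k / real n))" for k
    using lm[of k] by (intro integrable_mult_left integrable_real_indicator) (auto simp: fmeasurable_def)
  have int_s: "integrable lebesgue s"
    unfolding s_def by (intro Bochner_Integration.integrable_sum int_ind)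
  have integral_s: "integral\<^sup>L lebesgue s = (\<Sum>k<n*n. measure lebesgue (E \<inter> I k) * h (real k / real n))"
    unfolding s_def by (subst Bochner_Integration.integral_sum[OF int_ind]) simp
  have int_h: "integrable lebesgue (\<lambda>t. indicator E t * h t)"
    using set_integrable_subset[OF h E] by (simp add: set_integrable_def)
  have int_G: "integrable lebesgue (\<lambda>t. indicator {0..} t * G t)"
    using G by (simp add: set_integrable_def)
  have int_Gn: "integrable lebesgue (\<lambda>t. indicator {real n..} t * G t)"
    using set_integrable_subset[OF G, of "{real n..}"] by (simp add: set_integrable_def)
  have pointwise: "\<bar>s t - indicator E t * h t\<bar>
      \<le> e * (indicator {0..} t * G t) + indicator {real n..} t * G t" for t
  proof (cases "t \<in> E")
    case False
    have "0 \<le> G t" if "0 \<le> t" using bound[OF that] by linarith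
    then show ?thesis using False \<open>0 \<le> e\<close> by (auto simp: s_def indicator_def)
  next
    case True
    then have t: "0 \<le> t" using E by auto
    have G0: "0 \<le> G t" using bound[OF t] by linarith
    have s_t: "s t = (\<Sum>k<n*n. indicator (I k) t * h (real k / real n))"
      using True by (simp add: s_def indicator_inter_arith)
    show ?thesis
    proof (cases "t < real n")
      case tn: True
      obtain k where k: "real k / real n \<le> t" "t < (real k + 1) / real n" "s t = h (real k / real n)"
        by (rule sum_indicator_grid[OF \<open>0 < n\<close> t tn, of "\<lambda>k. h (real k / real n)"])
          (auto simp: s_t I_def)
      have "\<bar>real k / real n - t\<bar> < \<delta>"
        using k(1,2) \<open>1 / real n < \<delta>\<close> by (simp add: add_divide_distrib)
      then show ?thesis using modulus[of "real k / real n" t] k t tn True by simp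
    next
      case tn: False
      have "indicator (I k) t = (0::real)" if "k < n * n" for k
      proof -
        have "real (k + 1) \<le> real (n * n)"
          using that unfolding of_nat_le_iff by simp
        then have "(real k + 1) / real n \<le> real n" using \<open>0 < n\<close> by (simp add: divide_le_eq)
        then show ?thesis using tn by (simp add: I_def indicator_def)
      qed
      then have "s t = 0" by (simp add: s_t)
      then show ?thesis using tn True t bound[OF t] \<open>0 \<le> e\<close> G0
        by (simp add: add_increasing)
    qed
  qed
  have "\<bar>integral\<^sup>L lebesgue s - (LINT t:E|lebesgue. h t)\<bar> = \<bar>LINT t|lebesgue. s t - indicator E t * h t\<bar>"
    using int_s int_h by (simp add: set_lebesgue_integral_def)
  also have "\<dots> \<le> (LINT t|lebesgue. \<bar>s t - indicator E t * h t\<bar>)"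
    by (rule integral_abs_bound)
  also have "\<dots> \<le> (LINT t|lebesgue. e * (indicator {0..} t * G t) + indicator {real n..} t * G t)"
    using int_s int_h int_G int_Gn pointwise by (intro integral_mono) auto
  also have "\<dots> = e * (LINT t:{0..}|lebesgue. G t) + (LINT t:{real n..}|lebesgue. G t)"
    using int_G int_Gn by (simp add: set_lebesgue_integral_def)
  finally show ?thesis by (simp add: integral_s I_def)
qed

context normed_space_on
begin

lemma dual_diff:
  assumes "\<phi> \<in> topological_dual V N" "u \<in> V" "v \<in> V"
  shows "\<phi> (u - v) = \<phi> u - \<phi> v"
proof -
  have "\<phi> (u + (-1) *\<^sub>R v) = \<phi> u + (-1) *\<^sub>R \<phi> v"
    using assms subspace_scale[OF subspace_carrier]
    unfolding topological_dual_def bounded_linear_on_def mem_Collect_eq by metis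
  then show ?thesis by simp
qed

lemma dual_sum:
  assumes "\<phi> \<in> topological_dual V N" and "\<And>k. k \<in> A \<Longrightarrow> v k \<in> V"
  shows "\<phi> (\<Sum>k\<in>A. c k *\<^sub>R v k) = (\<Sum>k\<in>A. c k * \<phi> (v k))"
proof -
  have add: "\<phi> (u + v) = \<phi> u + \<phi> v" and scale: "\<phi> (a *\<^sub>R u) = a * \<phi> u"
    if "u \<in> V" "v \<in> V" for u v a
    using assms(1) that by (auto simp: topological_dual_def bounded_linear_on_def)
  have "0 \<in> V" using subspace_0[OF subspace_carrier] .
  then have zero: "\<phi> 0 = 0" using scale[of 0 0 0] by simp
  show ?thesis using assms(2)
  proof (induction A rule: infinite_finite_induct)
    case (insert k A)
    then have "(\<Sum>k\<in>A. c k *\<^sub>R v k) \<in> V" "c k *\<^sub>R v k \<in> V"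
      using subspace_carrier by (auto intro!: subspace_sum subspace_scale)
    then show ?case using insert by (simp add: add scale)
  qed (simp_all add: zero)
qed

lemma dual_bound:
  assumes "\<phi> \<in> topological_dual V N"
  obtains K where "0 \<le> K" "\<And>v. v \<in> V \<Longrightarrow> \<bar>\<phi> v\<bar> \<le> K * N v"
proof -
  have "\<exists>K. \<forall>v\<in>V. \<bar>\<phi> v\<bar> \<le> K * N v"
    using assms by (simp add: topological_dual_def bounded_linear_on_def)
  then obtain K where K: "\<And>v. v \<in> V \<Longrightarrow> \<bar>\<phi> v\<bar> \<le> K * N v" by blast
  show ?thesis
  proof (rule that[of "\<bar>K\<bar>"])
    fix v assume "v \<in> V"
    have "K * N v \<le> \<bar>K\<bar> * N v" using norm_nonneg[OF \<open>v \<in> V\<close>] by (intro mult_right_mono) auto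
    then show "\<bar>\<phi> v\<bar> \<le> \<bar>K\<bar> * N v" using K[OF \<open>v \<in> V\<close>] by linarith
  qed simp
qed

text \<open>
  The error bound for Riemann sums is applied to \<open>\<phi> \<circ> f\<close> for all functionals \<open>\<phi>\<close> at once: up to the
  bound \<open>K\<close> of \<open>\<phi>\<close> it does not depend on \<open>\<phi>\<close>. For \<open>\<phi>\<close> in the norming family \<open>\<Phi>\<close>, where \<open>K = 1\<close>, it
  makes the vector-valued Riemann sums a Cauchy sequence; for arbitrary \<open>\<phi>\<close> it identifies the value
  of \<open>\<phi>\<close> at their limit. By Hahn-Banach the whole unit ball of the dual is always norming, but in
  a concrete space an explicit family is at hand.
\<close>

theorem pettis_integrableI:
  assumes complete: mcomplete
    and \<Phi>: "\<Phi> \<subseteq> topological_dual V N"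
    and \<Phi>_le: "\<And>\<phi> v. \<phi> \<in> \<Phi> \<Longrightarrow> v \<in> V \<Longrightarrow> \<bar>\<phi> v\<bar> \<le> N v"
    and norming: "\<And>v c. v \<in> V \<Longrightarrow> (\<And>\<phi>. \<phi> \<in> \<Phi> \<Longrightarrow> \<bar>\<phi> v\<bar> \<le> c) \<Longrightarrow> N v \<le> c"
    and f: "\<And>t. 0 \<le> t \<Longrightarrow> f t \<in> V"
    and G: "set_integrable lebesgue {0..} G"
    and bound: "\<And>t. 0 \<le> t \<Longrightarrow> N (f t) \<le> G t"
    and modulus: "\<And>e. 0 < e \<Longrightarrow>
      \<exists>\<delta>>0. \<forall>s\<ge>0. \<forall>t\<ge>0. \<bar>s - t\<bar> < \<delta> \<longrightarrow> N (f s - f t) \<le> e * G t"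
  shows "pettis_integrable V N f"
proof -
  have G0: "0 \<le> G t" if "0 \<le> t" for t
    using norm_nonneg[OF f[OF that]] bound[OF that] by linarith
  have diffV: "u - v \<in> V" if "u \<in> V" "v \<in> V" for u v
    using that subspace_diff[OF subspace_carrier] by blast
  have dual_f_modulus: "\<bar>\<phi> (f s) - \<phi> (f t)\<bar> \<le> e * (K * G t)"
    if "\<phi> \<in> topological_dual V N" "0 \<le> K" "\<And>v. v \<in> V \<Longrightarrow> \<bar>\<phi> v\<bar> \<le> K * N v"
      "0 \<le> s" "0 \<le> t" "N (f s - f t) \<le> e * G t" for \<phi> K s t and e :: real
  proof -
    have "\<bar>\<phi> (f s) - \<phi> (f t)\<bar> \<le> K * N (f s - f t)"
      using that(3)[OF diffV[OF f f]] that by (simp add: dual_diff f)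
    also have "\<dots> \<le> K * (e * G t)" using that by (intro mult_left_mono) auto
    finally show ?thesis by (simp add: mult_ac)
  qed
  have integrable: "set_integrable lebesgue {0..} (\<lambda>t. \<phi> (f t))"
    if \<phi>: "\<phi> \<in> topological_dual V N" for \<phi>
  proof -
    obtain K where K: "0 \<le> K" "\<And>v. v \<in> V \<Longrightarrow> \<bar>\<phi> v\<bar> \<le> K * N v"
      using dual_bound[OF \<phi>] by blast
    have "continuous_on {0..} (\<lambda>t. \<phi> (f t))"
      unfolding continuous_on_iff
    proof (intro ballI allI impI)
      fix t e :: real assume t: "t \<in> {0..}" and e: "0 < e"
      define e' where "e' = e / (K * G t + 1)"
      have den: "0 < K * G t + 1" using K(1) G0[of t] t by (simp add: add_nonneg_pos)
      then have "0 < e'" using e by (simp add: e'_def)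
      then obtain \<delta> where \<delta>: "0 < \<delta>" "\<forall>s\<ge>0. \<forall>t\<ge>0. \<bar>s - t\<bar> < \<delta> \<longrightarrow> N (f s - f t) \<le> e' * G t"
        using modulus by blast
      have small: "e' * (K * G t) < e"
        using e den by (simp add: e'_def field_simps)
      show "\<exists>\<delta>>0. \<forall>s\<in>{0..}. dist s t < \<delta> \<longrightarrow> dist (\<phi> (f s)) (\<phi> (f t)) < e"
      proof (intro exI conjI ballI impI)
        fix s assume "s \<in> {0..}" "dist s t < \<delta>"
        then have "\<bar>\<phi> (f s) - \<phi> (f t)\<bar> \<le> e' * (K * G t)"
          using \<delta> t by (intro dual_f_modulus[OF \<phi> K]) (auto simp: dist_real_def)
        then show "dist (\<phi> (f s)) (\<phi> (f t)) < e" using small by (simp add: dist_real_def)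
      qed fact
    qed
    then have meas: "(\<lambda>t. \<phi> (f t)) \<in> borel_measurable (lebesgue_on {0..})"
      by (intro continuous_imp_measurable_on_sets_lebesgue) auto
    have "integrable (lebesgue_on {0..}) (\<lambda>t. \<phi> (f t))"
    proof (rule Bochner_Integration.integrable_bound)
      show "integrable (lebesgue_on {0..}) (\<lambda>t. K * G t)"
        using G by (simp add: integrable_restrict_space set_integrable_def)
      show "AE t in lebesgue_on {0..}. norm (\<phi> (f t)) \<le> norm (K * G t)"
      proof (rule AE_I2)
        fix t :: real assume "t \<in> space (lebesgue_on {0..})"
        then have t: "0 \<le> t" by simp
        have "\<bar>\<phi> (f t)\<bar> \<le> K * N (f t)" using K f t by blast
        also have "\<dots> \<le> K * G t" using K bound t by (intro mult_left_mono) auto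
        finally show "norm (\<phi> (f t)) \<le> norm (K * G t)" by simp
      qed
    qed (rule meas)
    then show ?thesis by (simp add: integrable_restrict_space set_integrable_def)
  qed
  have "\<exists>x\<in>V. \<forall>\<phi>\<in>topological_dual V N. \<phi> x = (LINT t:E|lebesgue. \<phi> (f t))"
    if E: "E \<in> sets lebesgue" "E \<subseteq> {0..}" for E
  proof -
    define x where "x n = (\<Sum>k<n*n. measure lebesgue (E \<inter> {real k / real n..<(real k + 1) / real n}) *\<^sub>R f (real k / real n))" for n
    have xV: "x n \<in> V" for n
      unfolding x_def using subspace_carrier by (auto intro!: subspace_sum subspace_scale f)
    have approx: "\<exists>n0. \<forall>n\<ge>n0. \<forall>\<phi>\<in>topological_dual V N. \<forall>K\<ge>0. (\<forall>v\<in>V. \<bar>\<phi> v\<bar> \<le> K * N v) \<longrightarrow>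
        \<bar>\<phi> (x n) - (LINT t:E|lebesgue. \<phi> (f t))\<bar> \<le> K * \<epsilon>" if \<epsilon>: "0 < \<epsilon>" for \<epsilon>
    proof -
      define c where "c = (LINT t:{0..}|lebesgue. G t)"
      have c: "0 \<le> c" unfolding c_def set_lebesgue_integral_def
        by (rule Bochner_Integration.integral_nonneg) (use G0 in \<open>auto simp: indicator_def\<close>)
      \<comment> \<open>The 1 in the denominator covers the case that the integral of \<open>G\<close> is 0.\<close>
      define e where "e = \<epsilon> / (2 * (c + 1))"
      have e: "0 < e" using \<epsilon> c by (simp add: e_def)
      have ec: "e * c \<le> \<epsilon> / 2" using \<epsilon> c by (simp add: e_def field_simps)
      obtain \<delta> where \<delta>: "0 < \<delta>" "\<forall>s\<ge>0. \<forall>t\<ge>0. \<bar>s - t\<bar> < \<delta> \<longrightarrow> N (f s - f t) \<le> e * G t"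
        using modulus[OF e] by blast
      obtain n1 :: nat where n1: "\<And>n. n \<ge> n1 \<Longrightarrow> \<bar>LINT t:{real n..}|lebesgue. G t\<bar> < \<epsilon> / 2"
        using LIMSEQ_D[OF integral_tail_tendsto_0[OF G], of "\<epsilon> / 2"] \<epsilon> by auto
      obtain n2 :: nat where n2: "1 / \<delta> < real n2" using reals_Archimedean2 by blast
      show ?thesis
      proof (intro exI[of _ "max n1 n2"] allI ballI impI)
        fix n \<phi> K assume n: "max n1 n2 \<le> n" and \<phi>: "\<phi> \<in> topological_dual V N"
          and K: "0 \<le> K" "\<forall>v\<in>V. \<bar>\<phi> v\<bar> \<le> K * N v"
        have "1 / \<delta> < real n" using n2 n by linarith
        moreover have "0 < 1 / \<delta>" using \<delta>(1) by simp
        ultimately have n0: "0 < n"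
          using of_nat_0_less_iff by (metis less_trans)
        have small: "1 / real n < \<delta>"
          using \<open>1 / \<delta> < real n\<close> n0 \<delta>(1) by (simp add: field_simps)
        have "\<bar>\<phi> (x n) - (LINT t:E|lebesgue. \<phi> (f t))\<bar>
          \<le> e * (LINT t:{0..}|lebesgue. K * G t) + (LINT t:{real n..}|lebesgue. K * G t)"
          unfolding x_def dual_sum[OF \<phi> f, OF divide_nonneg_nonneg, OF of_nat_0_le_iff of_nat_0_le_iff]
        proof (rule riemann_sum_error[OF integrable[OF \<phi>] _ _ _ _ n0 small E])
          show "set_integrable lebesgue {0..} (\<lambda>t. K * G t)" using G by simp
          show "\<bar>\<phi> (f t)\<bar> \<le> K * G t" if "0 \<le> t" for t
            using K f[OF that] mult_left_mono[OF bound[OF that] K(1)] by force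
          show "\<bar>\<phi> (f s) - \<phi> (f t)\<bar> \<le> e * (K * G t)" if "0 \<le> s" "0 \<le> t" "\<bar>s - t\<bar> < \<delta>" for s t
            using dual_f_modulus[OF \<phi> K(1)] K(2) \<delta> that by blast
        qed (use e in simp)
        also have "\<dots> = K * (e * c + (LINT t:{real n..}|lebesgue. G t))"
          by (simp add: c_def algebra_simps)
        also have "\<dots> \<le> K * \<epsilon>"
          using ec n1[of n] n K(1) by (intro mult_left_mono) auto
        finally show "\<bar>\<phi> (x n) - (LINT t:E|lebesgue. \<phi> (f t))\<bar> \<le> K * \<epsilon>" .
      qed
    qed
    have "MCauchy x"
      unfolding MCauchy_def
    proof (intro conjI allI impI)
      show "range x \<subseteq> V" using xV by blast
    next
      fix \<epsilon> :: real assume "0 < \<epsilon>"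
      then have "0 < \<epsilon> / 3" by simp
      from approx[OF this] obtain n0 where n0:
        "\<And>n \<phi> K. n \<ge> n0 \<Longrightarrow> \<phi> \<in> topological_dual V N \<Longrightarrow> K \<ge> 0 \<Longrightarrow> (\<forall>v\<in>V. \<bar>\<phi> v\<bar> \<le> K * N v) \<Longrightarrow>
          \<bar>\<phi> (x n) - (LINT t:E|lebesgue. \<phi> (f t))\<bar> \<le> K * (\<epsilon> / 3)" by blast
      have "norm_dist V N (x n) (x m) < \<epsilon>" if "n0 \<le> n" "n0 \<le> m" for n m
      proof -
        have "N (x n - x m) \<le> 2 * \<epsilon> / 3"
        proof (rule norming[OF diffV[OF xV xV]])
          fix \<phi> assume \<phi>: "\<phi> \<in> \<Phi>"
          then have d: "\<phi> \<in> topological_dual V N" using \<Phi> by blast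
          have "\<bar>\<phi> (x n) - (LINT t:E|lebesgue. \<phi> (f t))\<bar> \<le> \<epsilon> / 3"
            using n0[OF that(1) d, of 1] \<Phi>_le[OF \<phi>] by simp
          moreover have "\<bar>\<phi> (x m) - (LINT t:E|lebesgue. \<phi> (f t))\<bar> \<le> \<epsilon> / 3"
            using n0[OF that(2) d, of 1] \<Phi>_le[OF \<phi>] by simp
          ultimately show "\<bar>\<phi> (x n - x m)\<bar> \<le> 2 * \<epsilon> / 3"
            unfolding dual_diff[OF d xV xV] by linarith
        qed
        then show ?thesis using xV \<open>0 < \<epsilon>\<close> by (simp add: norm_dist_def)
      qed
      then show "\<exists>n0. \<forall>n m. n0 \<le> n \<longrightarrow> n0 \<le> m \<longrightarrow> norm_dist V N (x n) (x m) < \<epsilon>" by blast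
    qed
    then obtain y where lim: "limitin mtopology x y sequentially"
      using complete by (auto simp: mcomplete_def)
    then have yV: "y \<in> V" by (simp add: limit_metric_sequentially)
    have "\<phi> y = (LINT t:E|lebesgue. \<phi> (f t))" if \<phi>: "\<phi> \<in> topological_dual V N" for \<phi>
    proof -
      obtain K where K: "0 \<le> K" "\<And>v. v \<in> V \<Longrightarrow> \<bar>\<phi> v\<bar> \<le> K * N v"
        using dual_bound[OF \<phi>] by blast
      have "\<bar>\<phi> y - (LINT t:E|lebesgue. \<phi> (f t))\<bar> \<le> 0 + e" if "0 < e" for e
      proof -
        define \<epsilon> where "\<epsilon> = e / (2 * (K + 1))"
        have \<epsilon>: "0 < \<epsilon>" using that K by (simp add: \<epsilon>_def)
        from approx[OF \<epsilon>] obtain n1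
          where "\<forall>n\<ge>n1. \<forall>\<phi>\<in>topological_dual V N. \<forall>K\<ge>0. (\<forall>v\<in>V. \<bar>\<phi> v\<bar> \<le> K * N v) \<longrightarrow>
            \<bar>\<phi> (x n) - (LINT t:E|lebesgue. \<phi> (f t))\<bar> \<le> K * \<epsilon>" ..
        then have n1: "\<bar>\<phi> (x n) - (LINT t:E|lebesgue. \<phi> (f t))\<bar> \<le> K * \<epsilon>" if "n \<ge> n1" for n
          using \<phi> K that by simp
        obtain n2 where n2: "\<And>n. n \<ge> n2 \<Longrightarrow> norm_dist V N (x n) y < \<epsilon>"
          using lim \<epsilon> unfolding limit_metric_sequentially by blast
        define n where "n = max n1 n2"
        have "\<bar>\<phi> (x n) - \<phi> y\<bar> \<le> K * N (x n - y)"
          using K(2)[OF diffV[OF xV yV]] by (simp add: dual_diff[OF \<phi> xV yV])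
        also have "\<dots> \<le> K * \<epsilon>"
          using n2[of n] K(1) xV yV by (intro mult_left_mono) (auto simp: norm_dist_def n_def)
        finally have "\<bar>\<phi> y - (LINT t:E|lebesgue. \<phi> (f t))\<bar> \<le> 2 * (K * \<epsilon>)"
          using n1[of n] by (simp add: n_def)
        also have "\<dots> \<le> e" using that K by (simp add: \<epsilon>_def field_simps)
        finally show ?thesis by simp
      qed
      then have "\<bar>\<phi> y - (LINT t:E|lebesgue. \<phi> (f t))\<bar> \<le> 0" by (rule field_le_epsilon)
      then show ?thesis by simp
    qed
    then show ?thesis using yV by blast
  qed
  then show ?thesis
    unfolding pettis_integrable_def using f integrable by simp
qed

end


section \<open>The weighted space\<close>

text \<open>
  Replacing \<open>\<omega>\<close> by \<open>\<bar>\<omega>\<bar>\<close> makes the growth factor monotone in the elapsed time, so that one constant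
  serves for all times up to a given one.
\<close>

locale controlled_weight =
  fixes \<rho> :: "real \<Rightarrow> real" and M w :: real
  assumes weight_pos: "0 \<le> t \<Longrightarrow> 0 < \<rho> t"
    and M_ge_1: "1 \<le> M" and w_nonneg: "0 \<le> w"
    and weight_le: "0 \<le> \<tau> \<Longrightarrow> 0 \<le> t \<Longrightarrow> \<rho> \<tau> \<le> M * exp (w * t) * \<rho> (\<tau> + t)"

lemma admissible_weight_controlled:
  assumes "admissible_weight \<rho>"
  obtains M w where "controlled_weight \<rho> M w"
proof -
  obtain M \<omega> where M: "M \<ge> 1" and le: "\<And>\<tau> t. \<tau> \<ge> 0 \<Longrightarrow> t > 0 \<Longrightarrow> \<rho> \<tau> \<le> M * exp (\<omega> * t) * \<rho> (\<tau> + t)"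
    and pos: "\<And>t. t \<ge> 0 \<Longrightarrow> \<rho> t > 0"
    using assms unfolding admissible_weight_def by blast
  have "\<rho> \<tau> \<le> M * exp (\<bar>\<omega>\<bar> * t) * \<rho> (\<tau> + t)" if "0 \<le> \<tau>" "0 \<le> t" for \<tau> t
  proof (cases "t = 0")
    case True
    have "1 * \<rho> \<tau> \<le> M * \<rho> \<tau>" using M pos[OF that(1)] by (intro mult_right_mono) auto
    then show ?thesis using True by simp
  next
    case False
    have "\<omega> * t \<le> \<bar>\<omega>\<bar> * t" using that by (intro mult_right_mono) auto
    then have "M * exp (\<omega> * t) * \<rho> (\<tau> + t) \<le> M * exp (\<bar>\<omega>\<bar> * t) * \<rho> (\<tau> + t)"
      using M pos[of "\<tau> + t"] that by (intro mult_right_mono mult_left_mono) auto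
    then show ?thesis using le[of \<tau> t] that False by linarith
  qed
  then have "controlled_weight \<rho> M \<bar>\<omega>\<bar>" using M pos by unfold_locales auto
  then show ?thesis by (rule that)
qed

definition compactly_supported :: "(real \<Rightarrow> real) set"
  where "compactly_supported =
    {u. continuous_on {0..} u \<and> (\<forall>x<0. u x = 0) \<and> (\<exists>a\<ge>0. \<forall>x>a. u x = 0)}"

text \<open>
  A polynomial on \<open>[0, b]\<close> in Bernstein form with rational coefficients, times the function that is 1
  up to \<open>b - 1\<close> and descends linearly to 0 at \<open>b\<close>. Only the first \<open>n + 1\<close> entries of the list count;
  a shorter list yields some unspecified coefficients, which does no harm, as the family remains
  countable.
\<close>

definition rational_cutoff :: "nat \<Rightarrow> nat \<Rightarrow> rat list \<Rightarrow> real \<Rightarrow> real"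
  where "rational_cutoff b n qs x = (if x < 0 then 0
    else max 0 (min 1 (real b - x)) * (\<Sum>k\<le>n. of_rat (qs ! k) * Bernstein n k (x / real b)))"

lemma rational_cutoff_compactly_supported:
  "rational_cutoff b n qs \<in> compactly_supported"
proof -
  have "continuous_on {0..} (\<lambda>x. max 0 (min 1 (real b - x)) * (\<Sum>k\<le>n. of_rat (qs ! k) * Bernstein n k (x * c)))" for c
    unfolding Bernstein_def by (intro continuous_intros)
  from this[of "1 / real b"] have "continuous_on {0..} (rational_cutoff b n qs)"
    by (rule continuous_on_eq) (simp add: rational_cutoff_def)
  moreover have "\<forall>x>real b. rational_cutoff b n qs x = 0"
    by (simp add: rational_cutoff_def)
  moreover have "\<forall>x<0. rational_cutoff b n qs x = 0"
    by (simp add: rational_cutoff_def)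
  ultimately show ?thesis unfolding compactly_supported_def using of_nat_0_le_iff by blast
qed

lemma bernstein_rational_approximation:
  fixes f :: "real \<Rightarrow> real"
  assumes f: "continuous_on {0..1} f" and e: "0 < e"
  obtains n and qs :: "rat list"
  where "\<And>x. x \<in> {0..1} \<Longrightarrow> \<bar>f x - (\<Sum>k\<le>n. of_rat (qs ! k) * Bernstein n k x)\<bar> < e"
proof -
  obtain n where n: "\<And>x. x \<in> {0..1} \<Longrightarrow> \<bar>f x - (\<Sum>k\<le>n. f (k / n) * Bernstein n k x)\<bar> < e / 2"
    using Bernstein_Weierstrass[OF f, of "e / 2"] e by auto
  have "\<exists>q::rat. f (k / n) < of_rat q \<and> of_rat q < f (k / n) + e / 2" for k :: nat
    using of_rat_dense[of "f (k / n)" "f (k / n) + e / 2"] e by auto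
  then obtain q :: "nat \<Rightarrow> rat" where q: "\<And>k. f (k / n) < of_rat (q k)" "\<And>k. of_rat (q k) < f (k / n) + e / 2"
    by metis
  define qs where "qs = map q [0..<Suc n]"
  have qs: "qs ! k = q k" if "k \<le> n" for k
    using that unfolding qs_def by (simp add: nth_map del: upt_Suc)
  show ?thesis
  proof (rule that)
    fix x :: real assume x: "x \<in> {0..1}"
    have "\<bar>(\<Sum>k\<le>n. f (k / n) * Bernstein n k x) - (\<Sum>k\<le>n. of_rat (qs ! k) * Bernstein n k x)\<bar>
      = \<bar>\<Sum>k\<le>n. (f (k / n) - of_rat (q k)) * Bernstein n k x\<bar>"
      by (simp add: sum_subtractf left_diff_distrib qs)
    also have "\<dots> \<le> (\<Sum>k\<le>n. \<bar>(f (k / n) - of_rat (q k)) * Bernstein n k x\<bar>)" by (rule sum_abs)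
    also have "\<dots> \<le> (\<Sum>k\<le>n. e / 2 * Bernstein n k x)"
    proof (rule sum_mono)
      fix k
      have "\<bar>f (k / n) - of_rat (q k)\<bar> \<le> e / 2" using q[of k] by linarith
      moreover have "0 \<le> Bernstein n k x" using x by (intro Bernstein_nonneg) auto
      ultimately show "\<bar>(f (k / n) - of_rat (q k)) * Bernstein n k x\<bar> \<le> e / 2 * Bernstein n k x"
        by (simp only: abs_mult abs_of_nonneg mult_right_mono)
    qed
    also have "\<dots> = e / 2" by (simp only: sum_distrib_left[symmetric] sum_Bernstein mult_1_right)
    finally show "\<bar>f x - (\<Sum>k\<le>n. of_rat (qs ! k) * Bernstein n k x)\<bar> < e"
      using n[OF x] by linarith
  qed
qed

context controlled_weight
begin

abbreviation (input) "C0 \<equiv> C0_weighted \<rho>"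
abbreviation (input) "Nrm \<equiv> weighted_norm \<rho>"

lemma weight_le_later:
  assumes "0 \<le> x" "x \<le> y" "y - x \<le> l"
  shows "\<rho> x \<le> M * exp (w * l) * \<rho> y"
proof -
  have "\<rho> x \<le> M * exp (w * (y - x)) * \<rho> y" using weight_le[of x "y - x"] assms by simp
  also have "\<dots> \<le> M * exp (w * l) * \<rho> y"
    using assms M_ge_1 w_nonneg weight_pos[of y]
    by (intro mult_right_mono mult_left_mono) (auto intro: mult_left_mono)
  finally show ?thesis .
qed

lemma weight_bounded_above:
  obtains C where "0 < C" "\<And>x. 0 \<le> x \<Longrightarrow> x \<le> b \<Longrightarrow> \<rho> x \<le> C"
proof
  show "0 < M * exp (w * max 0 b) * \<rho> (max 0 b)" using M_ge_1 weight_pos by simp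
  show "\<rho> x \<le> M * exp (w * max 0 b) * \<rho> (max 0 b)" if "0 \<le> x" "x \<le> b" for x
    using that by (intro weight_le_later) auto
qed

lemma weight_bounded_below:
  obtains c where "0 < c" "\<And>x. 0 \<le> x \<Longrightarrow> x \<le> b \<Longrightarrow> c \<le> \<rho> x"
proof
  show "0 < \<rho> 0 / (M * exp (w * b))" using M_ge_1 weight_pos by simp
  show "\<rho> 0 / (M * exp (w * b)) \<le> \<rho> x" if "0 \<le> x" "x \<le> b" for x
    using weight_le_later[of 0 x b] that M_ge_1 by (simp add: field_simps)
qed

lemma C0_small_tail:
  assumes "u \<in> C0" "0 < e"
  obtains b where "0 \<le> b" "\<And>x. b \<le> x \<Longrightarrow> \<bar>u x\<bar> * \<rho> x < e"
proof -
  have "((\<lambda>x. u x * \<rho> x) \<longlongrightarrow> 0) at_top" using assms by (simp add: C0_weighted_def)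
  then have "eventually (\<lambda>x. \<bar>u x * \<rho> x\<bar> < e) at_top"
    using assms(2) by (auto simp: tendsto_iff dist_real_def)
  then obtain b where b: "\<And>x. b \<le> x \<Longrightarrow> \<bar>u x * \<rho> x\<bar> < e"
    unfolding eventually_at_top_linorder by blast
  show ?thesis
  proof (rule that[of "max 0 b"])
    fix x assume "max 0 b \<le> x"
    then have "\<bar>u x * \<rho> x\<bar> < e" "0 < \<rho> x" using b weight_pos by auto
    then show "\<bar>u x\<bar> * \<rho> x < e" by (simp add: abs_mult)
  qed simp
qed

lemma C0I:
  assumes "continuous_on {0..} u" "\<And>x. x < 0 \<Longrightarrow> u x = 0"
    and "\<And>e. 0 < e \<Longrightarrow> \<exists>b. \<forall>x\<ge>b. 0 \<le> x \<longrightarrow> \<bar>u x\<bar> * \<rho> x \<le> e"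
  shows "u \<in> C0"
proof -
  have "((\<lambda>x. u x * \<rho> x) \<longlongrightarrow> 0) at_top"
    unfolding tendsto_iff eventually_at_top_linorder
  proof (intro allI impI)
    fix e :: real assume "0 < e"
    then obtain b where b: "\<And>x. b \<le> x \<Longrightarrow> 0 \<le> x \<Longrightarrow> \<bar>u x\<bar> * \<rho> x \<le> e / 2"
      using assms(3)[of "e / 2"] by auto
    have "dist (u x * \<rho> x) 0 < e" if "max 0 b \<le> x" for x
    proof -
      have "\<bar>u x\<bar> * \<rho> x \<le> e / 2" "0 < \<rho> x" using b weight_pos that by auto
      then show ?thesis using \<open>0 < e\<close> by (simp add: abs_mult)
    qed
    then show "\<exists>b. \<forall>x\<ge>b. dist (u x * \<rho> x) 0 < e" by blast
  qed
  then show ?thesis using assms by (simp add: C0_weighted_def)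
qed

lemma compactly_supported_subset: "compactly_supported \<subseteq> C0"
proof
  fix u assume "u \<in> compactly_supported"
  then obtain a where "continuous_on {0..} u" "\<forall>x<0. u x = 0" and a: "\<forall>x>a. u x = 0"
    by (auto simp: compactly_supported_def)
  then show "u \<in> C0"
    by (intro C0I) (auto intro!: exI[of _ "a + 1"])
qed

lemma bdd_above_weighted:
  assumes "u \<in> C0"
  shows "bdd_above ((\<lambda>t. \<bar>u t\<bar> * \<rho> t) ` {0..})"
proof -
  obtain b where b: "\<And>x. b \<le> x \<Longrightarrow> \<bar>u x\<bar> * \<rho> x < 1" using C0_small_tail[OF assms, of 1] by auto
  obtain C where C: "0 < C" "\<And>x. 0 \<le> x \<Longrightarrow> x \<le> b \<Longrightarrow> \<rho> x \<le> C" using weight_bounded_above by blast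
  have "continuous_on {0..b} u"
    using assms by (auto simp: C0_weighted_def intro: continuous_on_subset)
  then have "bounded (u ` {0..b})"
    using compact_continuous_image compact_imp_bounded compact_Icc by blast
  then obtain B where B: "\<And>x. 0 \<le> x \<Longrightarrow> x \<le> b \<Longrightarrow> \<bar>u x\<bar> \<le> B"
    unfolding bounded_iff by force
  show ?thesis
  proof (rule bdd_aboveI2)
    fix x :: real assume "x \<in> {0..}"
    then have x: "0 \<le> x" by simp
    show "\<bar>u x\<bar> * \<rho> x \<le> max 1 (B * C)"
    proof (cases "b \<le> x")
      case True
      then show ?thesis using b[of x] by simp
    next
      case False
      then have "\<bar>u x\<bar> * \<rho> x \<le> B * C"
        using x B[of x] C weight_pos[OF x] by (intro mult_mono) auto
      then show ?thesis by simp
    qed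
  qed
qed

lemma weighted_le_norm:
  assumes "u \<in> C0" "0 \<le> t"
  shows "\<bar>u t\<bar> * \<rho> t \<le> Nrm u"
  unfolding weighted_norm_def
  using cSUP_upper[OF _ bdd_above_weighted[OF assms(1)], of t] assms(2) by simp

lemma weighted_norm_le:
  assumes "\<And>t. 0 \<le> t \<Longrightarrow> \<bar>u t\<bar> * \<rho> t \<le> c"
  shows "Nrm u \<le> c"
  unfolding weighted_norm_def by (rule cSUP_least) (use assms in auto)

lemma subspace_C0: "subspace C0"
proof (rule subspaceI)
  show "0 \<in> C0" by (simp add: C0_weighted_def zero_fun_def)
next
  fix u v assume "u \<in> C0" "v \<in> C0"
  then show "u + v \<in> C0"
    using tendsto_add[of "\<lambda>x. u x * \<rho> x" 0 at_top "\<lambda>x. v x * \<rho> x" 0]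
    by (auto simp: C0_weighted_def plus_fun_def distrib_right intro: continuous_intros)
next
  fix c and u assume "u \<in> C0"
  then show "c *\<^sub>R u \<in> C0"
    using tendsto_mult_left[of "\<lambda>x. u x * \<rho> x" 0 at_top c]
    by (auto simp: C0_weighted_def scaleR_fun_def mult.assoc intro: continuous_intros)
qed

sublocale space: normed_space_on "C0_weighted \<rho>" "weighted_norm \<rho>"
proof
  show "subspace C0" by (rule subspace_C0)
next
  fix u assume u: "u \<in> C0"
  show "Nrm u = 0 \<longleftrightarrow> u = 0"
  proof
    assume *: "Nrm u = 0"
    have "u x = 0" for x
    proof (cases "x < 0")
      case False
      then show ?thesis using weighted_le_norm[OF u, of x] weight_pos[of x] *
        by (simp add: mult_le_0_iff)
    qed (use u in \<open>simp add: C0_weighted_def\<close>)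
    then show "u = 0" by (simp add: fun_eq_iff)
  qed (simp add: weighted_norm_def)
next
  fix u c assume u: "u \<in> C0"
  have cu: "c *\<^sub>R u \<in> C0" using subspace_scale[OF subspace_C0 u] .
  show "Nrm (c *\<^sub>R u) = \<bar>c\<bar> * Nrm u"
  proof (rule antisym)
    show "Nrm (c *\<^sub>R u) \<le> \<bar>c\<bar> * Nrm u"
      using weighted_le_norm[OF u]
      by (intro weighted_norm_le) (simp add: scaleR_fun_def abs_mult mult.assoc mult_left_mono)
    show "\<bar>c\<bar> * Nrm u \<le> Nrm (c *\<^sub>R u)"
    proof (cases "c = 0")
      case True
      then show ?thesis using weighted_le_norm[OF cu, of 0] weight_pos[of 0]
        by (simp add: scaleR_fun_def)
    next
      case False
      have "Nrm u \<le> Nrm (c *\<^sub>R u) / \<bar>c\<bar>"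
        using weighted_le_norm[OF cu] False
        by (intro weighted_norm_le) (simp add: scaleR_fun_def abs_mult field_simps)
      then show ?thesis using False by (simp add: field_simps)
    qed
  qed
next
  fix u v assume u: "u \<in> C0" and v: "v \<in> C0"
  show "Nrm (u + v) \<le> Nrm u + Nrm v"
  proof (rule weighted_norm_le)
    fix t :: real assume t: "0 \<le> t"
    have "\<bar>u t + v t\<bar> * \<rho> t \<le> (\<bar>u t\<bar> + \<bar>v t\<bar>) * \<rho> t"
      using weight_pos[OF t] by (intro mult_right_mono) auto
    then show "\<bar>(u + v) t\<bar> * \<rho> t \<le> Nrm u + Nrm v"
      using weighted_le_norm[OF u t] weighted_le_norm[OF v t] by (simp add: distrib_right)
  qed
qed

text \<open>
  A Cauchy sequence converges pointwise, and uniformly after multiplication by the weight. Since the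
  weight is bounded away from 0 on bounded intervals, the convergence there is uniform without the
  weight too, which makes the limit continuous; the decay at infinity passes to the limit directly.
\<close>

lemma complete_C0: "space.mcomplete"
  unfolding space.mcomplete_def
proof (intro allI impI)
  fix \<sigma> assume Cauchy: "space.MCauchy \<sigma>"
  then have "range \<sigma> \<subseteq> C0" unfolding space.MCauchy_def ..
  then have \<sigma>: "\<sigma> n \<in> C0" for n by blast
  have diff: "u - v \<in> C0" if "u \<in> C0" "v \<in> C0" for u v
    using that by (rule subspace_diff[OF subspace_C0])
  have close: "\<exists>n0. \<forall>n\<ge>n0. \<forall>m\<ge>n0. \<forall>y\<ge>0. \<bar>\<sigma> n y - \<sigma> m y\<bar> * \<rho> y \<le> e" if "0 < e" for e
  proof -
    from Cauchy that obtain n0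
      where "\<forall>n m. n0 \<le> n \<longrightarrow> n0 \<le> m \<longrightarrow> norm_dist C0 Nrm (\<sigma> n) (\<sigma> m) < e"
      unfolding space.MCauchy_def by meson
    then have n0: "norm_dist C0 Nrm (\<sigma> n) (\<sigma> m) < e" if "n0 \<le> n" "n0 \<le> m" for n m
      using that by simp
    have "\<bar>\<sigma> n y - \<sigma> m y\<bar> * \<rho> y \<le> e" if "n0 \<le> n" "n0 \<le> m" "0 \<le> y" for n m y
    proof -
      have "\<bar>(\<sigma> n - \<sigma> m) y\<bar> * \<rho> y \<le> Nrm (\<sigma> n - \<sigma> m)"
        by (rule weighted_le_norm[OF diff[OF \<sigma> \<sigma>] that(3)])
      moreover have "Nrm (\<sigma> n - \<sigma> m) < e"
        using n0[OF that(1,2)] \<sigma> by (simp add: norm_dist_def)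
      ultimately show ?thesis by simp
    qed
    then show ?thesis by blast
  qed
  have "convergent (\<lambda>n. \<sigma> n y)" for y
  proof (cases "y < 0")
    case True
    then have "\<sigma> n y = 0" for n using \<sigma> by (simp add: C0_weighted_def)
    then show ?thesis by (simp add: convergent_const)
  next
    case False
    then have \<rho>: "0 < \<rho> y" using weight_pos by simp
    have "Cauchy (\<lambda>n. \<sigma> n y)"
    proof (rule metric_CauchyI)
      fix e :: real assume "0 < e"
      then have "0 < e / 2 * \<rho> y" using \<rho> by simp
      from close[OF this] obtain n0
        where "\<forall>n\<ge>n0. \<forall>m\<ge>n0. \<forall>z\<ge>0. \<bar>\<sigma> n z - \<sigma> m z\<bar> * \<rho> z \<le> e / 2 * \<rho> y" ..
      then have n0: "\<bar>\<sigma> n y - \<sigma> m y\<bar> * \<rho> y \<le> e / 2 * \<rho> y" if "n0 \<le> n" "n0 \<le> m" for n m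
        using False that by simp
      have "dist (\<sigma> n y) (\<sigma> m y) < e" if "n0 \<le> n" "n0 \<le> m" for n m
      proof -
        have "\<bar>\<sigma> n y - \<sigma> m y\<bar> \<le> e / 2" using n0[OF that] \<rho> by (simp only: mult_le_cancel_right_pos)
        then show ?thesis using \<open>0 < e\<close> by (simp add: dist_real_def)
      qed
      then show "\<exists>n0. \<forall>m\<ge>n0. \<forall>n\<ge>n0. dist (\<sigma> m y) (\<sigma> n y) < e" by blast
    qed
    then show ?thesis by (simp add: Cauchy_convergent_iff)
  qed
  then have "\<forall>y. \<exists>l. (\<lambda>n. \<sigma> n y) \<longlonglongrightarrow> l" unfolding convergent_def by blast
  then obtain v where v: "\<And>y. (\<lambda>n. \<sigma> n y) \<longlonglongrightarrow> v y" by metis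
  have uniform: "\<exists>n0. \<forall>n\<ge>n0. \<forall>y\<ge>0. \<bar>\<sigma> n y - v y\<bar> * \<rho> y \<le> e" if "0 < e" for e
  proof -
    from close[OF that] obtain n0
      where n0: "\<And>n m y. n0 \<le> n \<Longrightarrow> n0 \<le> m \<Longrightarrow> 0 \<le> y \<Longrightarrow> \<bar>\<sigma> n y - \<sigma> m y\<bar> * \<rho> y \<le> e"
      by blast
    have "\<bar>\<sigma> n y - v y\<bar> * \<rho> y \<le> e" if "n0 \<le> n" "0 \<le> y" for n y
    proof (rule LIMSEQ_le_const2)
      show "(\<lambda>m. \<bar>\<sigma> n y - \<sigma> m y\<bar> * \<rho> y) \<longlonglongrightarrow> \<bar>\<sigma> n y - v y\<bar> * \<rho> y"
        by (intro tendsto_intros v)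
      show "\<exists>N. \<forall>m\<ge>N. \<bar>\<sigma> n y - \<sigma> m y\<bar> * \<rho> y \<le> e" using n0 that by blast
    qed
    then show ?thesis by blast
  qed
  have "v \<in> C0"
  proof (rule C0I)
    show "v x = 0" if "x < 0" for x
      using \<sigma> that by (intro LIMSEQ_unique[OF v]) (simp add: C0_weighted_def)
    show "\<exists>b. \<forall>x\<ge>b. 0 \<le> x \<longrightarrow> \<bar>v x\<bar> * \<rho> x \<le> e" if "0 < e" for e
    proof -
      have e2: "0 < e / 2" using that by simp
      obtain n where n: "\<And>y. 0 \<le> y \<Longrightarrow> \<bar>\<sigma> n y - v y\<bar> * \<rho> y \<le> e / 2"
        using uniform[OF e2] by blast
      obtain b where b: "\<And>x. b \<le> x \<Longrightarrow> \<bar>\<sigma> n x\<bar> * \<rho> x < e / 2"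
        using C0_small_tail[OF \<sigma> e2] by blast
      have "\<bar>v x\<bar> * \<rho> x \<le> e" if "b \<le> x" "0 \<le> x" for x
      proof -
        have "\<bar>v x\<bar> * \<rho> x \<le> (\<bar>\<sigma> n x\<bar> + \<bar>\<sigma> n x - v x\<bar>) * \<rho> x"
          using weight_pos[OF that(2)] by (intro mult_right_mono) auto
        then show ?thesis using n[OF that(2)] b[OF that(1)] by (simp add: distrib_right)
      qed
      then show ?thesis by blast
    qed
    show "continuous_on {0..} v"
      unfolding continuous_on_iff
    proof (intro ballI allI impI)
      fix x e :: real assume x: "x \<in> {0..}" and e: "0 < e"
      obtain c where c: "0 < c" "\<And>y. 0 \<le> y \<Longrightarrow> y \<le> x + 1 \<Longrightarrow> c \<le> \<rho> y"
        using weight_bounded_below by blast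
      have "0 < e / 3 * c" using e c by simp
      from uniform[OF this] obtain n
        where n: "\<And>y. 0 \<le> y \<Longrightarrow> \<bar>\<sigma> n y - v y\<bar> * \<rho> y \<le> e / 3 * c" by blast
      have near: "\<bar>\<sigma> n y - v y\<bar> \<le> e / 3" if "0 \<le> y" "y \<le> x + 1" for y
      proof -
        have "\<bar>\<sigma> n y - v y\<bar> * c \<le> \<bar>\<sigma> n y - v y\<bar> * \<rho> y"
          using c(2)[OF that] by (intro mult_left_mono) auto
        also have "\<dots> \<le> e / 3 * c" using n[OF that(1)] .
        finally show ?thesis using c(1) by simp
      qed
      have "continuous_on {0..} (\<sigma> n)" using \<sigma> by (simp add: C0_weighted_def)
      moreover have "0 < e / 3" using e by simp
      ultimately obtain d where d: "0 < d" "\<And>y. y \<in> {0..} \<Longrightarrow> dist y x < d \<Longrightarrow> dist (\<sigma> n y) (\<sigma> n x) < e / 3"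
        using x unfolding continuous_on_iff by blast
      show "\<exists>d>0. \<forall>y\<in>{0..}. dist y x < d \<longrightarrow> dist (v y) (v x) < e"
      proof (intro exI[of _ "min d 1"] conjI ballI impI)
        fix y assume y: "y \<in> {0..}" "dist y x < min d 1"
        then have "\<bar>\<sigma> n y - v y\<bar> \<le> e / 3" "\<bar>\<sigma> n x - v x\<bar> \<le> e / 3"
          using near[of y] near[of x] x by (auto simp: dist_real_def)
        moreover have "\<bar>\<sigma> n y - \<sigma> n x\<bar> < e / 3" using d(2)[of y] y by (simp add: dist_real_def)
        ultimately show "dist (v y) (v x) < e" unfolding dist_real_def by linarith
      qed (use d in simp)
    qed
  qed
  moreover have "\<exists>n0. \<forall>n\<ge>n0. \<sigma> n \<in> C0 \<and> norm_dist C0 Nrm (\<sigma> n) v < e" if "0 < e" for e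
  proof -
    have "0 < e / 2" using that by simp
    from uniform[OF this] obtain n0
      where n0: "\<And>n y. n0 \<le> n \<Longrightarrow> 0 \<le> y \<Longrightarrow> \<bar>\<sigma> n y - v y\<bar> * \<rho> y \<le> e / 2" by blast
    have "Nrm (\<sigma> n - v) \<le> e / 2" if "n0 \<le> n" for n
      using n0[OF that] by (intro weighted_norm_le) simp
    then have "norm_dist C0 Nrm (\<sigma> n) v < e" if "n0 \<le> n" for n
      using that \<sigma> \<open>v \<in> C0\<close> \<open>0 < e\<close> by (force simp: norm_dist_def)
    then show ?thesis using \<sigma> by blast
  qed
  ultimately show "\<exists>v. limitin space.mtopology \<sigma> v sequentially"
    unfolding space.limit_metric_sequentially by blast
qed

text \<open>
  Write \<open>c\<close> for the cutoff and \<open>p\<close> for the polynomial. Then \<open>u - c p = (1 - c) u + c (u - p)\<close>. The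
  first term lives where the weighted \<open>u\<close> is already small; the second lives on \<open>[0, b]\<close>, where the
  weight is bounded by a constant \<open>C\<close> known before \<open>p\<close> is chosen.
\<close>

lemma rational_cutoff_dense:
  assumes u: "u \<in> C0" and r: "0 < r"
  obtains b n qs where "Nrm (u - rational_cutoff b n qs) < r"
proof -
  have "0 < r / 3" using r by simp
  obtain b0 where b0: "0 \<le> b0" "\<And>x. b0 \<le> x \<Longrightarrow> \<bar>u x\<bar> * \<rho> x < r / 3"
    using C0_small_tail[OF u \<open>0 < r / 3\<close>] by blast
  obtain b :: nat where b: "b0 + 1 < real b" using reals_Archimedean2 by blast
  have b_pos: "0 < real b" using b b0 by simp
  obtain C where C: "0 < C" "\<And>x. 0 \<le> x \<Longrightarrow> x \<le> real b \<Longrightarrow> \<rho> x \<le> C"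
    using weight_bounded_above by blast
  have "continuous_on {0..1} (\<lambda>z. u (real b * z))"
    by (rule continuous_on_compose2[of "{0..}" u]) (use u in \<open>auto simp: C0_weighted_def intro!: continuous_intros\<close>)
  moreover have "0 < r / (3 * C)" using r C by simp
  ultimately obtain n and qs :: "rat list" where approx: "\<And>z. z \<in> {0..1} \<Longrightarrow>
      \<bar>u (real b * z) - (\<Sum>k\<le>n. of_rat (qs ! k) * Bernstein n k z)\<bar> < r / (3 * C)"
    using bernstein_rational_approximation by blast
  define p where "p x = (\<Sum>k\<le>n. of_rat (qs ! k) * Bernstein n k (x / real b))" for x
  have "Nrm (u - rational_cutoff b n qs) \<le> 2 * r / 3"
  proof (rule weighted_norm_le)
    fix x :: real assume x: "0 \<le> x"
    define c where "c = max 0 (min 1 (real b - x))"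
    have c: "0 \<le> c" "c \<le> 1" by (auto simp: c_def)
    have \<rho>: "0 < \<rho> x" using weight_pos[OF x] .
    have "(1 - c) * (\<bar>u x\<bar> * \<rho> x) \<le> r / 3"
    proof (cases "b0 \<le> x")
      case True
      have "(1 - c) * (\<bar>u x\<bar> * \<rho> x) \<le> 1 * (\<bar>u x\<bar> * \<rho> x)"
        using c \<rho> by (intro mult_right_mono) auto
      then show ?thesis using b0(2)[OF True] by simp
    next
      case False
      then have "c = 1" using b by (simp add: c_def)
      then show ?thesis using r by simp
    qed
    moreover have "c * (\<bar>u x - p x\<bar> * \<rho> x) \<le> r / 3"
    proof (cases "x \<le> real b")
      case True
      have "\<bar>u x - p x\<bar> < r / (3 * C)"
        using approx[of "x / real b"] x True b_pos by (simp add: p_def)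
      then have "\<bar>u x - p x\<bar> * \<rho> x \<le> r / (3 * C) * C"
        using C(1) C(2)[OF x True] \<rho> by (intro mult_mono) auto
      then have *: "\<bar>u x - p x\<bar> * \<rho> x \<le> r / 3" using C(1) by simp
      have "c * (\<bar>u x - p x\<bar> * \<rho> x) \<le> 1 * (\<bar>u x - p x\<bar> * \<rho> x)"
        using c \<rho> by (intro mult_right_mono) auto
      then show ?thesis using * by simp
    next
      case False
      then have "c = 0" by (simp add: c_def)
      then show ?thesis using r by simp
    qed
    moreover have "\<bar>(u - rational_cutoff b n qs) x\<bar> * \<rho> x
      \<le> (1 - c) * (\<bar>u x\<bar> * \<rho> x) + c * (\<bar>u x - p x\<bar> * \<rho> x)"
    proof -
      have "(u - rational_cutoff b n qs) x = (1 - c) * u x + c * (u x - p x)"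
        using x by (simp add: rational_cutoff_def c_def p_def algebra_simps)
      then have "\<bar>(u - rational_cutoff b n qs) x\<bar> \<le> (1 - c) * \<bar>u x\<bar> + c * \<bar>u x - p x\<bar>"
        using abs_triangle_ineq[of "(1 - c) * u x" "c * (u x - p x)"] c by (simp add: abs_mult)
      then have "\<bar>(u - rational_cutoff b n qs) x\<bar> * \<rho> x \<le> ((1 - c) * \<bar>u x\<bar> + c * \<bar>u x - p x\<bar>) * \<rho> x"
        using \<rho> by (intro mult_right_mono) auto
      then show ?thesis by (simp add: algebra_simps)
    qed
    ultimately show "\<bar>(u - rational_cutoff b n qs) x\<bar> * \<rho> x \<le> 2 * r / 3" by linarith
  qed
  then have "Nrm (u - rational_cutoff b n qs) < r" using r by linarith
  then show ?thesis by (rule that)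
qed

lemma closure_rational_cutoffs:
  "space.mtopology closure_of (range (\<lambda>(b, n, qs). rational_cutoff b n qs)) = C0"
  (is "_ closure_of ?D = _")
proof -
  have D: "d \<in> C0" if "d \<in> ?D" for d
    using that rational_cutoff_compactly_supported compactly_supported_subset by auto
  have "\<exists>d\<in>?D. d \<in> space.mball u r" if u: "u \<in> C0" and r: "0 < r" for u r
  proof -
    obtain b n qs where *: "Nrm (u - rational_cutoff b n qs) < r"
      using rational_cutoff_dense[OF u r] .
    have mem: "rational_cutoff b n qs \<in> ?D" by (rule range_eqI[of _ _ "(b, n, qs)"]) simp
    then have "rational_cutoff b n qs \<in> space.mball u r"
      using u D * by (simp add: space.in_mball norm_dist_def)
    then show ?thesis using mem by blast
  qed
  then show ?thesis unfolding space.metric_closure_of by blast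
qed

lemma separable_C0: "separable_space space.mtopology"
proof -
  let ?D = "range (\<lambda>(b, n, qs). rational_cutoff b n qs)"
  have "countable ?D" by simp
  moreover have "?D \<subseteq> topspace space.mtopology"
    using rational_cutoff_compactly_supported compactly_supported_subset by auto
  moreover have "space.mtopology closure_of ?D = topspace space.mtopology"
    by (simp add: closure_rational_cutoffs)
  ultimately show ?thesis
    unfolding separable_space_def by (intro exI[of _ ?D] conjI)
qed

lemma closure_compactly_supported: "space.mtopology closure_of compactly_supported = C0"
proof (rule antisym)
  show "space.mtopology closure_of compactly_supported \<subseteq> C0"
    using closure_of_subset_topspace[of space.mtopology] by simp
  have "range (\<lambda>(b, n, qs). rational_cutoff b n qs) \<subseteq> compactly_supported"
    using rational_cutoff_compactly_supported by auto
  from closure_of_mono[OF this, of space.mtopology]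
  show "C0 \<subseteq> space.mtopology closure_of compactly_supported"
    by (simp add: closure_rational_cutoffs)
qed

end


section \<open>The translation semigroup\<close>

context controlled_weight
begin

lemma translation_weighted_le:
  assumes "0 \<le> t" "0 \<le> x"
  shows "\<bar>u (x + t)\<bar> * \<rho> x \<le> M * exp (w * t) * (\<bar>u (x + t)\<bar> * \<rho> (x + t))"
proof -
  have "\<bar>u (x + t)\<bar> * \<rho> x \<le> \<bar>u (x + t)\<bar> * (M * exp (w * t) * \<rho> (x + t))"
    using weight_le assms by (intro mult_left_mono) auto
  then show ?thesis by (simp only: mult_ac)
qed

lemma translation_in_C0:
  assumes u: "u \<in> C0" and t: "0 \<le> t"
  shows "translation t u \<in> C0"
proof (rule C0I)
  have "continuous_on {0..} (\<lambda>x. u (x + t))"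
    by (rule continuous_on_compose2[of "{0..}" u])
      (use u t in \<open>auto simp: C0_weighted_def intro!: continuous_intros\<close>)
  then show "continuous_on {0..} (translation t u)"
    by (rule continuous_on_eq) (simp add: translation_def)
  show "translation t u x = 0" if "x < 0" for x
    using that by (simp add: translation_def)
  show "\<exists>b. \<forall>x\<ge>b. 0 \<le> x \<longrightarrow> \<bar>translation t u x\<bar> * \<rho> x \<le> e" if "0 < e" for e
  proof -
    define K where "K = M * exp (w * t)"
    have K: "0 < K" using M_ge_1 by (simp add: K_def)
    have "0 < e / K" using that K by simp
    from C0_small_tail[OF u this] obtain b where b: "\<And>x. b \<le> x \<Longrightarrow> \<bar>u x\<bar> * \<rho> x < e / K" by blast
    have "\<bar>translation t u x\<bar> * \<rho> x \<le> e" if x: "b \<le> x" "0 \<le> x" for x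
    proof -
      have "\<bar>u (x + t)\<bar> * \<rho> x \<le> K * (\<bar>u (x + t)\<bar> * \<rho> (x + t))"
        unfolding K_def by (rule translation_weighted_le[OF t x(2)])
      also have "\<dots> \<le> K * (e / K)"
        using b[of "x + t"] x t K by (intro mult_left_mono) auto
      finally show ?thesis using x K by (simp add: translation_def)
    qed
    then show ?thesis by blast
  qed
qed

lemma translation_bounded_linear:
  assumes t: "0 \<le> t"
  shows "bounded_linear_on C0 Nrm Nrm (translation t)"
  unfolding bounded_linear_on_def
proof (intro conjI exI ballI allI)
  show "translation t (u + v) = translation t u + translation t v" for u v
    by (auto simp: translation_def fun_eq_iff)
  show "translation t (c *\<^sub>R u) = c *\<^sub>R translation t u" for c u
    by (auto simp: translation_def scaleR_fun_def fun_eq_iff)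
  fix u assume u: "u \<in> C0"
  show "Nrm (translation t u) \<le> M * exp (w * t) * Nrm u"
  proof (rule weighted_norm_le)
    fix x :: real assume x: "0 \<le> x"
    have "\<bar>u (x + t)\<bar> * \<rho> x \<le> M * exp (w * t) * (\<bar>u (x + t)\<bar> * \<rho> (x + t))"
      by (rule translation_weighted_le[OF t x])
    also have "\<dots> \<le> M * exp (w * t) * Nrm u"
      using weighted_le_norm[OF u, of "x + t"] x t M_ge_1 by (intro mult_left_mono) auto
    finally show "\<bar>translation t u x\<bar> * \<rho> x \<le> M * exp (w * t) * Nrm u"
      using x by (simp add: translation_def)
  qed
qed

text \<open>
  Beyond some \<open>b\<close> both \<open>u\<close> and its translates by at most 1 have small weighted values; on \<open>[0, b]\<close>
  the weight is bounded and \<open>u\<close> is uniformly continuous.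
\<close>

lemma translation_strongly_continuous:
  assumes u: "u \<in> C0"
  shows "limitin space.mtopology (\<lambda>t. translation t u) u (at_right 0)"
  unfolding space.limitin_metric
proof (intro conjI allI impI u)
  fix e :: real assume e: "0 < e"
  define K where "K = M * exp w"
  have K: "1 \<le> K" using M_ge_1 w_nonneg mult_mono[of 1 M 1 "exp w"] by (simp add: K_def)
  define r where "r = e / (4 * K)"
  have r: "0 < r" "K * r = e / 4" using e K by (auto simp: r_def)
  have "r \<le> K * r" using K r(1) by simp
  then have r_le: "r \<le> e / 4" using r by simp
  obtain b where b: "0 \<le> b" "\<And>x. b \<le> x \<Longrightarrow> \<bar>u x\<bar> * \<rho> x < r"
    using C0_small_tail[OF u r(1)] by blast
  obtain C where C: "0 < C" "\<And>x. 0 \<le> x \<Longrightarrow> x \<le> b \<Longrightarrow> \<rho> x \<le> C"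
    using weight_bounded_above by blast
  have "continuous_on {0..b + 1} u"
    using u by (auto simp: C0_weighted_def intro: continuous_on_subset)
  then have "uniformly_continuous_on {0..b + 1} u"
    by (intro compact_uniformly_continuous) auto
  moreover have "0 < e / (2 * C)" using e C by simp
  ultimately obtain d where d: "0 < d"
    "\<And>x y. x \<in> {0..b + 1} \<Longrightarrow> y \<in> {0..b + 1} \<Longrightarrow> dist y x < d \<Longrightarrow> dist (u y) (u x) < e / (2 * C)"
    unfolding uniformly_continuous_on_def by blast
  have small: "Nrm (translation t u - u) \<le> e / 2" if t: "0 < t" "t < min d 1" for t
  proof (rule weighted_norm_le)
    fix x :: real assume x: "0 \<le> x"
    have \<rho>: "0 < \<rho> x" using weight_pos[OF x] .
    have "\<bar>u (x + t) - u x\<bar> * \<rho> x \<le> e / 2"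
    proof (cases "x \<le> b")
      case True
      have "\<bar>u (x + t) - u x\<bar> < e / (2 * C)"
        using d(2)[of x "x + t"] x t True by (simp add: dist_real_def)
      then have "\<bar>u (x + t) - u x\<bar> * \<rho> x \<le> e / (2 * C) * C"
        using C(1) C(2)[OF x True] \<rho> by (intro mult_mono) auto
      then show ?thesis using C by simp
    next
      case False
      have "M * exp (w * t) \<le> K"
        unfolding K_def using M_ge_1 w_nonneg t by (intro mult_left_mono) (auto intro: mult_left_le)
      then have "M * exp (w * t) * (\<bar>u (x + t)\<bar> * \<rho> (x + t)) \<le> K * r"
        using b(2)[of "x + t"] False t x K M_ge_1 weight_pos[of "x + t"] by (intro mult_mono) auto
      then have "\<bar>u (x + t)\<bar> * \<rho> x \<le> e / 4"
        using translation_weighted_le[OF _ x, of t u] t r(2) by simp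
      moreover have "\<bar>u x\<bar> * \<rho> x \<le> e / 4" using b(2)[of x] False r_le by simp
      moreover have "\<bar>u (x + t) - u x\<bar> * \<rho> x \<le> (\<bar>u (x + t)\<bar> + \<bar>u x\<bar>) * \<rho> x"
        using \<rho> by (intro mult_right_mono) auto
      ultimately show ?thesis by (simp add: distrib_right)
    qed
    then show "\<bar>(translation t u - u) x\<bar> * \<rho> x \<le> e / 2"
      using x by (simp add: translation_def)
  qed
  have "norm_dist C0 Nrm (translation t u) u < e" if "0 < t" "t < min d 1" for t
    using small[OF that] translation_in_C0[OF u, of t] u that e by (simp add: norm_dist_def)
  then show "eventually (\<lambda>t. translation t u \<in> C0 \<and> norm_dist C0 Nrm (translation t u) u < e) (at_right 0)"
    unfolding eventually_at_right_field
    using d(1) translation_in_C0[OF u] by (intro exI[of _ "min d 1"]) auto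
qed

lemma C0_semigroup_translation: "C0_semigroup_on C0 Nrm translation"
proof unfold_locales
  show "space.mcomplete" by (rule complete_C0)
  show "separable_space space.mtopology" by (rule separable_C0)
  show "translation t u \<in> C0" if "0 \<le> t" "u \<in> C0" for t u
    using that by (rule translation_in_C0[rotated])
  show "bounded_linear_on C0 Nrm Nrm (translation t)" if "0 \<le> t" for t
    using that by (rule translation_bounded_linear)
  show "translation 0 u = u" if "u \<in> C0" for u
    using that by (auto simp: translation_def C0_weighted_def fun_eq_iff)
  show "translation (s + t) u = translation s (translation t u)"
    if "0 \<le> s" "0 \<le> t" "u \<in> C0" for s t u
    using that by (auto simp: translation_def fun_eq_iff add.assoc)
  show "limitin space.mtopology (\<lambda>t. translation t u) u (at_right 0)" if "u \<in> C0" for u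
    using that by (rule translation_strongly_continuous)
qed

end


section \<open>Right inverses of the translations\<close>

text \<open>
  The extension of \<open>u\<close> to the line that runs linearly from \<open>u 0\<close> to 0 on \<open>[-1, 0]\<close>. Written as a
  product of continuous functions, so that continuity at 0 needs no case distinction.
\<close>

definition left_extension :: "(real \<Rightarrow> real) \<Rightarrow> real \<Rightarrow> real"
  where "left_extension u x = u (max 0 x) * max 0 (min 1 (1 + x))"

definition right_translation :: "real \<Rightarrow> (real \<Rightarrow> real) \<Rightarrow> real \<Rightarrow> real"
  where "right_translation t u x = (if 0 \<le> x then left_extension u (x - t) else 0)"

lemma left_extension_nonneg: "0 \<le> x \<Longrightarrow> left_extension u x = u x"
  by (simp add: left_extension_def)

lemma left_extension_left: "x \<le> -1 \<Longrightarrow> left_extension u x = 0"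
  by (simp add: left_extension_def)

lemma continuous_left_extension:
  assumes "continuous_on {0..} u"
  shows "continuous_on UNIV (left_extension u)"
proof -
  have "continuous_on UNIV (\<lambda>x::real. u (max 0 x))"
    by (rule continuous_on_compose2[OF assms]) (auto intro!: continuous_intros)
  then show ?thesis
    unfolding left_extension_def by (intro continuous_intros)
qed

lemma translation_right_translation:
  assumes "u \<in> compactly_supported" "0 \<le> t"
  shows "translation t (right_translation t u) = u"
proof
  fix x show "translation t (right_translation t u) x = u x"
    using assms
    by (cases "0 \<le> x") (auto simp: translation_def right_translation_def left_extension_nonneg
        compactly_supported_def)
qed

lemma translation_right_translation_diff:
  assumes "0 \<le> t" "t \<le> r"
  shows "translation t (right_translation r u) = right_translation (r - t) u"
  using assms by (auto simp: translation_def right_translation_def fun_eq_iff algebra_simps)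

lemma uniformly_continuous_if_supported_Icc:
  fixes f :: "real \<Rightarrow> real"
  assumes cont: "continuous_on UNIV f" and supp: "\<And>x. x \<notin> {a..b} \<Longrightarrow> f x = 0" and e: "0 < e"
  obtains d where "0 < d" "\<And>x y. \<bar>x - y\<bar> < d \<Longrightarrow> \<bar>f x - f y\<bar> < e"
proof -
  have "uniformly_continuous_on {a - 1..b + 1} f"
    by (intro compact_uniformly_continuous continuous_on_subset[OF cont]) auto
  then obtain d where d: "0 < d"
    "\<And>x y. x \<in> {a - 1..b + 1} \<Longrightarrow> y \<in> {a - 1..b + 1} \<Longrightarrow> dist y x < d \<Longrightarrow> dist (f y) (f x) < e"
    using e unfolding uniformly_continuous_on_def by blast
  have *: "\<bar>f x - f y\<bar> < e" if "\<bar>x - y\<bar> < min d 1" for x y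
  proof (cases "x \<in> {a - 1..b + 1} \<and> y \<in> {a - 1..b + 1}")
    case True
    then show ?thesis using d(2)[of y x] that by (simp add: dist_real_def)
  next
    case False
    then have "x \<notin> {a..b}" "y \<notin> {a..b}" using that by auto
    then show ?thesis using supp e by simp
  qed
  show ?thesis by (rule that[of "min d 1"]) (use d(1) * in simp_all)
qed

text \<open>
  Collects what the domination estimates for both orbits use. The modulus \<open>d\<close> is kept at most 1 so
  that moving the time by less than \<open>d\<close> moves the support by at most 1.
\<close>

lemma left_extension_bounded_uniform:
  assumes u: "u \<in> compactly_supported"
  obtains a B where "0 \<le> a" "0 < B" "\<And>x. x \<notin> {-1..a} \<Longrightarrow> left_extension u x = 0"
    "\<And>x. \<bar>left_extension u x\<bar> \<le> B"
    "\<And>e. 0 < e \<Longrightarrow> \<exists>d>0. d \<le> 1 \<and> (\<forall>x y. \<bar>x - y\<bar> < d \<longrightarrow> \<bar>left_extension u x - left_extension u y\<bar> < e)"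
proof -
  obtain a where a: "0 \<le> a" "\<forall>x>a. u x = 0" and cont: "continuous_on {0..} u"
    using u unfolding compactly_supported_def by blast
  have cont': "continuous_on UNIV (left_extension u)" using continuous_left_extension[OF cont] .
  have supp: "left_extension u x = 0" if "x \<notin> {-1..a}" for x
    using that a by (cases "x \<le> -1") (auto simp: left_extension_left left_extension_nonneg)
  have "bounded (left_extension u ` {-1..a})"
    using cont' by (intro compact_imp_bounded compact_continuous_image) (auto intro: continuous_on_subset)
  then obtain B where B: "0 < B" "\<And>x. x \<in> {-1..a} \<Longrightarrow> \<bar>left_extension u x\<bar> \<le> B"
    unfolding bounded_pos by auto
  show ?thesis
  proof (rule that[OF a(1) B(1) supp])
    show "\<bar>left_extension u x\<bar> \<le> B" for x
      using B supp[of x] by (cases "x \<in> {-1..a}") auto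
    show "\<exists>d>0. d \<le> 1 \<and> (\<forall>x y. \<bar>x - y\<bar> < d \<longrightarrow> \<bar>left_extension u x - left_extension u y\<bar> < e)"
      if e: "0 < e" for e
    proof -
      obtain d where d: "0 < d" "\<And>x y. \<bar>x - y\<bar> < d \<Longrightarrow> \<bar>left_extension u x - left_extension u y\<bar> < e"
        using uniformly_continuous_if_supported_Icc[OF cont' supp e] by blast
      then show ?thesis by (intro exI[of _ "min d 1"]) auto
    qed
  qed
qed

context controlled_weight
begin

text \<open>
  Here the norming family consists of the point evaluations times the weight, so that every
  hypothesis becomes a pointwise estimate.
\<close>

lemma pettis_integrable_C0I:
  assumes f: "\<And>t. 0 \<le> t \<Longrightarrow> f t \<in> C0"
    and G: "set_integrable lebesgue {0..} G"
    and bound: "\<And>t x. 0 \<le> t \<Longrightarrow> 0 \<le> x \<Longrightarrow> \<bar>f t x\<bar> * \<rho> x \<le> G t"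
    and modulus: "\<And>e. 0 < e \<Longrightarrow> \<exists>\<delta>>0. \<forall>s\<ge>0. \<forall>t\<ge>0. \<bar>s - t\<bar> < \<delta> \<longrightarrow>
        (\<forall>x\<ge>0. \<bar>f s x - f t x\<bar> * \<rho> x \<le> e * G t)"
  shows "pettis_integrable C0 Nrm f"
proof (rule space.pettis_integrableI[OF complete_C0, where G = G])
  let ?\<Phi> = "(\<lambda>y u. u y * \<rho> y) ` {0..}"
  have le: "\<bar>\<phi> u\<bar> \<le> Nrm u" if "\<phi> \<in> ?\<Phi>" "u \<in> C0" for \<phi> u
    using that weighted_le_norm[OF that(2)] weight_pos by (auto simp: abs_mult less_imp_le)
  then show "\<bar>\<phi> u\<bar> \<le> Nrm u" if "\<phi> \<in> ?\<Phi>" "u \<in> C0" for \<phi> u using that .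
  show "?\<Phi> \<subseteq> topological_dual C0 Nrm"
  proof
    fix \<phi> assume \<phi>: "\<phi> \<in> ?\<Phi>"
    then have "\<forall>u\<in>C0. \<bar>\<phi> u\<bar> \<le> 1 * Nrm u" using le by simp
    moreover have "\<forall>u\<in>C0. \<forall>v\<in>C0. \<phi> (u + v) = \<phi> u + \<phi> v" "\<forall>c. \<forall>u\<in>C0. \<phi> (c *\<^sub>R u) = c *\<^sub>R \<phi> u"
      using \<phi> by (auto simp: distrib_right scaleR_fun_def)
    ultimately show "\<phi> \<in> topological_dual C0 Nrm"
      unfolding topological_dual_def bounded_linear_on_def by blast
  qed
  show "Nrm u \<le> c" if "\<And>\<phi>. \<phi> \<in> ?\<Phi> \<Longrightarrow> \<bar>\<phi> u\<bar> \<le> c" for u c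
  proof (rule weighted_norm_le)
    fix t :: real assume "0 \<le> t"
    then show "\<bar>u t\<bar> * \<rho> t \<le> c"
      using that[of "\<lambda>u. u t * \<rho> t"] weight_pos[of t] by (simp add: abs_mult)
  qed
  show "Nrm (f t) \<le> G t" if "0 \<le> t" for t
    using bound[OF that] by (rule weighted_norm_le)
  fix e :: real assume "0 < e"
  from modulus[OF this] obtain \<delta> where \<delta>: "0 < \<delta>"
    "\<And>s t x. 0 \<le> s \<Longrightarrow> 0 \<le> t \<Longrightarrow> \<bar>s - t\<bar> < \<delta> \<Longrightarrow> 0 \<le> x \<Longrightarrow> \<bar>f s x - f t x\<bar> * \<rho> x \<le> e * G t"
    by blast
  have "Nrm (f s - f t) \<le> e * G t" if "0 \<le> s" "0 \<le> t" "\<bar>s - t\<bar> < \<delta>" for s t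
    using \<delta>(2)[OF that] by (intro weighted_norm_le) simp
  then show "\<exists>\<delta>>0. \<forall>s\<ge>0. \<forall>t\<ge>0. \<bar>s - t\<bar> < \<delta> \<longrightarrow> Nrm (f s - f t) \<le> e * G t"
    using \<delta>(1) by blast
qed (use f G in auto)

text \<open>
  The translates vanish once \<open>t\<close> exceeds the end \<open>a\<close> of the support, so a constant on \<open>[0, a + 1]\<close>
  dominates; the extra unit leaves room for the neighbouring time in the modulus estimate.
\<close>

lemma pettis_integrable_translation:
  assumes u: "u \<in> compactly_supported"
  shows "pettis_integrable C0 Nrm (\<lambda>t. translation t u)"
proof -
  obtain a B where a: "0 \<le> a" and B: "0 < B"
    and supp: "\<And>x. x \<notin> {-1..a} \<Longrightarrow> left_extension u x = 0"
    and le_B: "\<And>x. \<bar>left_extension u x\<bar> \<le> B"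
    and unif: "\<And>e. 0 < e \<Longrightarrow> \<exists>d>0. d \<le> 1 \<and> (\<forall>x y. \<bar>x - y\<bar> < d \<longrightarrow> \<bar>left_extension u x - left_extension u y\<bar> < e)"
    using left_extension_bounded_uniform[OF u] by blast
  obtain C where C: "0 < C" "\<And>x. 0 \<le> x \<Longrightarrow> x \<le> a + 1 \<Longrightarrow> \<rho> x \<le> C"
    using weight_bounded_above by blast
  have eq: "translation t u x = left_extension u (x + t)" if "0 \<le> t" "0 \<le> x" for t x
    using that by (simp add: translation_def left_extension_nonneg)
  \<comment> \<open>The factor \<open>B\<close> serves the bound, the factor 1 the modulus; the maximum dominates both.\<close>
  define G where "G t = max 1 B * C * indicator {0..a + 1} t" for t :: real
  show ?thesis
  proof (rule pettis_integrable_C0I[where G = G])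
    show "translation t u \<in> C0" if "0 \<le> t" for t
      using u compactly_supported_subset that by (intro translation_in_C0) auto
    have "integrable lebesgue (\<lambda>t. max 1 B * C * indicator {0..a + 1} t :: real)"
      using a by (intro integrable_mult_right integrable_real_indicator) auto
    then show "set_integrable lebesgue {0..} G"
      unfolding set_integrable_def G_def
      by (rule Bochner_Integration.integrable_cong[THEN iffD1, rotated 2]) (auto simp: indicator_def)
    show "\<bar>translation t u x\<bar> * \<rho> x \<le> G t" if "0 \<le> t" "0 \<le> x" for t x
    proof (cases "x + t \<le> a")
      case True
      have "\<bar>left_extension u (x + t)\<bar> * \<rho> x \<le> max 1 B * C"
        using le_B[of "x + t"] C(2)[of x] that True weight_pos[of x] by (intro mult_mono) auto
      then show ?thesis using that True by (simp add: eq G_def)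
    next
      case False
      then show ?thesis using that C by (simp add: eq supp G_def)
    qed
    fix e :: real assume "0 < e"
    from unif[OF this] obtain d where d: "0 < d" "d \<le> 1"
      "\<And>x y. \<bar>x - y\<bar> < d \<Longrightarrow> \<bar>left_extension u x - left_extension u y\<bar> < e" by blast
    have "\<bar>translation s u x - translation t u x\<bar> * \<rho> x \<le> e * G t"
      if "0 \<le> s" "0 \<le> t" "\<bar>s - t\<bar> < d" "0 \<le> x" for s t x
    proof (cases "x + t \<le> a + 1")
      case True
      have "\<bar>left_extension u (x + s) - left_extension u (x + t)\<bar> \<le> e"
        using d(3)[of "x + s" "x + t"] that by simp
      then have "\<bar>left_extension u (x + s) - left_extension u (x + t)\<bar> * \<rho> x \<le> e * C"
        using C(2)[of x] that True weight_pos[of x] \<open>0 < e\<close> by (intro mult_mono) auto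
      also have "\<dots> \<le> e * (max 1 B * C)"
        using \<open>0 < e\<close> C(1) by (intro mult_left_mono) auto
      finally show ?thesis using that True by (simp add: eq G_def)
    next
      case False
      then have "x + t > a" "x + s > a" using that d(2) by auto
      then show ?thesis using that C(1) \<open>0 < e\<close> by (simp add: eq supp G_def)
    qed
    then show "\<exists>\<delta>>0. \<forall>s\<ge>0. \<forall>t\<ge>0. \<bar>s - t\<bar> < \<delta> \<longrightarrow>
        (\<forall>x\<ge>0. \<bar>translation s u x - translation t u x\<bar> * \<rho> x \<le> e * G t)"
      using d(1) by blast
  qed
qed

lemma right_translation_in_C0:
  assumes u: "u \<in> compactly_supported"
  shows "right_translation t u \<in> C0"
proof (rule C0I)
  obtain a where supp: "\<And>x. x \<notin> {-1..a} \<Longrightarrow> left_extension u x = 0"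
    using left_extension_bounded_uniform[OF u] by metis
  have "continuous_on UNIV (left_extension u)"
    using u by (intro continuous_left_extension) (simp add: compactly_supported_def)
  then have "continuous_on {0..} (\<lambda>x. left_extension u (x - t))"
    by (rule continuous_on_compose2) (auto intro!: continuous_intros)
  then show "continuous_on {0..} (right_translation t u)"
    by (rule continuous_on_eq) (simp add: right_translation_def)
  show "right_translation t u x = 0" if "x < 0" for x
    using that by (simp add: right_translation_def)
  show "\<exists>b. \<forall>x\<ge>b. 0 \<le> x \<longrightarrow> \<bar>right_translation t u x\<bar> * \<rho> x \<le> e" if "0 < e" for e
    using that by (intro exI[of _ "a + t + 1"]) (simp add: right_translation_def supp)
qed

lemma set_integrable_shifted_weight:
  assumes \<rho>: "set_integrable lebesgue {0..} \<rho>" and c: "0 \<le> c"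
  shows "set_integrable lebesgue {0..} (\<lambda>t. \<rho> (t + c))"
proof -
  have "integrable lebesgue (\<lambda>t. indicator {0..} t * \<rho> t)"
    using \<rho> by (simp add: set_integrable_def)
  from lebesgue_integrable_real_affine[OF this, of 1 c]
  moreover have "(\<lambda>t. indicator {0..} (c + 1 * t) * \<rho> (c + 1 * t)) = (\<lambda>t. indicator {-c..} t * \<rho> (t + c))"
    by (auto simp: fun_eq_iff indicator_def add.commute)
  ultimately have "integrable lebesgue (\<lambda>t. indicator {-c..} t * \<rho> (t + c))" by simp
  then have "set_integrable lebesgue {-c..} (\<lambda>t. \<rho> (t + c))"
    by (simp add: set_integrable_def)
  then show ?thesis by (rule set_integrable_subset) (use c in auto)
qed

text \<open>
  For times \<open>s\<close> within distance 1 of \<open>t\<close> the function \<open>S\<^sub>s u\<close> lives on \<open>[t - 2, t + a + 1]\<close>. There the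
  weight is at most \<open>K * \<rho> (t + a + 1)\<close>, as the right end of this interval is at most \<open>a + 3\<close> later.
  This is the place where integrability of the weight enters.
\<close>

lemma pettis_integrable_right_translation:
  assumes \<rho>: "set_integrable lebesgue {0..} \<rho>" and u: "u \<in> compactly_supported"
  shows "pettis_integrable C0 Nrm (\<lambda>t. right_translation t u)"
proof -
  obtain a B where a: "0 \<le> a" and B: "0 < B"
    and supp: "\<And>x. x \<notin> {-1..a} \<Longrightarrow> left_extension u x = 0"
    and le_B: "\<And>x. \<bar>left_extension u x\<bar> \<le> B"
    and unif: "\<And>e. 0 < e \<Longrightarrow> \<exists>d>0. d \<le> 1 \<and> (\<forall>x y. \<bar>x - y\<bar> < d \<longrightarrow> \<bar>left_extension u x - left_extension u y\<bar> < e)"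
    using left_extension_bounded_uniform[OF u] by blast
  define c where "c = a + 1"
  define K where "K = M * exp (w * (c + 2))"
  \<comment> \<open>As for the translates, \<open>B\<close> serves the bound and 1 the modulus.\<close>
  define G where "G t = max 1 B * (K * \<rho> (t + c))" for t
  have K: "0 < K" using M_ge_1 by (simp add: K_def)
  have \<rho>_le: "\<rho> x \<le> K * \<rho> (t + c)" if "0 \<le> x" "t - 2 \<le> x" "x \<le> t + c" for x t
    unfolding K_def using that by (intro weight_le_later) auto
  show ?thesis
  proof (rule pettis_integrable_C0I[where G = G])
    show "right_translation t u \<in> C0" for t using right_translation_in_C0[OF u] .
    show "set_integrable lebesgue {0..} G"
      unfolding G_def using set_integrable_shifted_weight[OF \<rho>, of c] a
      by (intro set_integrable_mult_right) (auto simp: c_def)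
    have pos: "0 < \<rho> (t + c)" if "0 \<le> t" for t using that a by (intro weight_pos) (simp add: c_def)
    show "\<bar>right_translation t u x\<bar> * \<rho> x \<le> G t" if "0 \<le> t" "0 \<le> x" for t x
    proof (cases "x - t \<in> {-1..a}")
      case True
      then have "\<rho> x \<le> K * \<rho> (t + c)" using that by (intro \<rho>_le) (auto simp: c_def)
      then have "\<bar>left_extension u (x - t)\<bar> * \<rho> x \<le> max 1 B * (K * \<rho> (t + c))"
        using le_B[of "x - t"] weight_pos[OF that(2)] by (intro mult_mono) auto
      then show ?thesis using that by (simp add: right_translation_def G_def)
    next
      case False
      then show ?thesis using that K pos[OF that(1)] by (simp add: right_translation_def supp G_def)
    qed
    fix e :: real assume e: "0 < e"
    from unif[OF this] obtain d where d: "0 < d" "d \<le> 1"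
      "\<And>x y. \<bar>x - y\<bar> < d \<Longrightarrow> \<bar>left_extension u x - left_extension u y\<bar> < e" by blast
    have "\<bar>right_translation s u x - right_translation t u x\<bar> * \<rho> x \<le> e * G t"
      if "0 \<le> s" "0 \<le> t" "\<bar>s - t\<bar> < d" "0 \<le> x" for s t x
    proof (cases "x - t \<in> {-2..c}")
      case True
      have "\<bar>left_extension u (x - s) - left_extension u (x - t)\<bar> \<le> e"
        using d(3)[of "x - s" "x - t"] that by (simp add: abs_minus_commute less_imp_le)
      moreover have "\<rho> x \<le> K * \<rho> (t + c)" using that True by (intro \<rho>_le) auto
      ultimately have "\<bar>left_extension u (x - s) - left_extension u (x - t)\<bar> * \<rho> x \<le> e * (K * \<rho> (t + c))"
        using weight_pos[OF that(4)] e by (intro mult_mono) auto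
      also have "\<dots> \<le> e * (max 1 B * (K * \<rho> (t + c)))"
        using e K pos[OF that(2)] mult_right_mono[of 1 "max 1 B" "K * \<rho> (t + c)"]
        by (intro mult_left_mono) auto
      finally show ?thesis using that by (simp add: right_translation_def G_def)
    next
      case False
      then have "x - t \<notin> {-1..a}" "x - s \<notin> {-1..a}" using that d(2) by (auto simp: c_def)
      then show ?thesis using that e K pos[OF that(2)] by (simp add: right_translation_def supp G_def)
    qed
    then show "\<exists>\<delta>>0. \<forall>s\<ge>0. \<forall>t\<ge>0. \<bar>s - t\<bar> < \<delta> \<longrightarrow>
        (\<forall>x\<ge>0. \<bar>right_translation s u x - right_translation t u x\<bar> * \<rho> x \<le> e * G t)"
      using d(1) by blast
  qed
qed

end

lemma set_integrable_weight:
  assumes meas: "\<rho> \<in> borel_measurable (lebesgue_on {0..})" and pos: "\<And>t. 0 \<le> t \<Longrightarrow> 0 < \<rho> t"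
    and fin: "(\<integral>\<^sup>+ s\<in>{0..}. ennreal (\<rho> s) \<partial>lebesgue) < \<infinity>"
  shows "set_integrable lebesgue {0..} (\<rho> :: real \<Rightarrow> real)"
  unfolding set_integrable_def
proof (rule integrableI_bounded)
  show "(\<lambda>t. indicator {0..} t *\<^sub>R \<rho> t) \<in> borel_measurable lebesgue"
    using meas by (subst (asm) borel_measurable_restrict_space_iff) auto
  have "(\<integral>\<^sup>+ t. ennreal (norm (indicator {0..} t *\<^sub>R \<rho> t)) \<partial>lebesgue)
      = (\<integral>\<^sup>+ s\<in>{0..}. ennreal (\<rho> s) \<partial>lebesgue)"
    using pos by (intro nn_integral_cong) (auto simp: indicator_def less_imp_le)
  then show "(\<integral>\<^sup>+ t. ennreal (norm (indicator {0..} t *\<^sub>R \<rho> t)) \<partial>lebesgue) < \<infinity>"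
    using fin by simp
qed

theorem proposition3p4:
  fixes \<rho> :: "real \<Rightarrow> real"
  assumes "admissible_weight \<rho>"
    and "(\<integral>\<^sup>+ s\<in>{0..}. ennreal (\<rho> s) \<partial>lebesgue) < \<infinity>"
  shows "frequent_hypercyclicity_criterion (C0_weighted \<rho>) (weighted_norm \<rho>) translation"
proof -
  obtain M w where "controlled_weight \<rho> M w"
    using admissible_weight_controlled[OF assms(1)] .
  then interpret controlled_weight \<rho> M w .
  have \<rho>: "set_integrable lebesgue {0..} \<rho>"
    using assms by (intro set_integrable_weight) (auto simp: admissible_weight_def)
  show ?thesis
    unfolding frequent_hypercyclicity_criterion_def
  proof (intro conjI exI[of _ compactly_supported] exI[of _ right_translation] ballI allI impI)
    show "C0_semigroup_on (C0_weighted \<rho>) (weighted_norm \<rho>) translation"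
      by (rule C0_semigroup_translation)
    show "compactly_supported \<subseteq> C0_weighted \<rho>" by (rule compactly_supported_subset)
    show "space.mtopology closure_of compactly_supported = C0_weighted \<rho>"
      by (rule closure_compactly_supported)
  next
    fix t :: real and u assume "0 < t" "u \<in> compactly_supported"
    then show "right_translation t u \<in> C0_weighted \<rho>" by (intro right_translation_in_C0)
    show "translation t (right_translation t u) = u"
      using \<open>0 < t\<close> \<open>u \<in> compactly_supported\<close> by (intro translation_right_translation) auto
    show "translation t (right_translation r u) = right_translation (r - t) u" if "t < r" for r
      using \<open>0 < t\<close> that by (intro translation_right_translation_diff) auto
  next
    fix u assume "u \<in> compactly_supported"
    then show "pettis_integrable (C0_weighted \<rho>) (weighted_norm \<rho>) (\<lambda>t. translation t u)"
      by (rule pettis_integrable_translation)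
    show "pettis_integrable (C0_weighted \<rho>) (weighted_norm \<rho>) (\<lambda>t. right_translation t u)"
      using \<rho> \<open>u \<in> compactly_supported\<close> by (rule pettis_integrable_right_translation)
  qed
qed

end
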